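(* Suppose that $\epsilon>0$ is a sufficiently small constant. If $p$ is a sufficiently large prime and $K$ is an integer such that there exists a value of $t$ on the unit circle, in the arc from $\zeta_p^K$ to $\zeta_p^{K+1}$, with $|f_p(t)|<\epsilon\sqrt{p}$, then there exists $\tau = r\,\zeta_p^{K+\theta}$ with $f_p(\tau)=0$, where $0<\theta<1$ and $1-\epsilon^{1/3}/p < r\le 1$.
   Context: For an odd prime $p$, $\left(\frac{\cdot}{p}\right)$ denotes the Legendre symbol and the Fekete polynomial is $f_p(t) := \sum_{a=0}^{p-1} \left(\frac{a}{p}\right) t^a$. Here $\zeta_p = e^{2\pi i/p}$ and, for real $y$, $\zeta_p^{y} := e^{2\pi i y/p}$; the arc from $\zeta_p^K$ to $\zeta_p^{K+1}$ is the arc of the unit circle traversed by $\zeta_p^{K+x}$ as $x$ goes from $0$ to $1$.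
   Formalization: The formal theorem also assumes that p divides neither K nor K+1 (neither end of the arc is t = 1); on those two arcs the hypothesis always holds because f_p(1) = 0, but for large p and small ε there is no zero with 0 < θ < 1 as claimed. *)

theory Defs
  imports "HOL-Analysis.Analysis" "HOL-Number_Theory.Number_Theory"
begin

definition fekete :: "nat \<Rightarrow> complex \<Rightarrow> complex" where
  "fekete p t = (\<Sum>a=0..p-1. of_int (Legendre (int a) (int p)) * t ^ a)"

(* the power zeta_p^y, for real exponents y *)
definition zeta_pow :: "nat \<Rightarrow> real \<Rightarrow> complex" where
  "zeta_pow p y = exp (2 * of_real pi * \<i> * of_real y / of_nat p)"

(* If p divides K or K + 1, one end point of the arc is the trivial zero t = 1 of
   fekete p; smallness on such an arc says nothing about zeros inside it. *)
definition zeta_arc :: "nat \<Rightarrow> int \<Rightarrow> complex set" where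
  "zeta_arc p K = (\<lambda>x. zeta_pow p (of_int K + x)) ` {0..1}"

end

theory Submission
  imports Defs "HOL-Complex_Analysis.Conformal_Mappings"
begin

text \<open>
  Write \<open>\<zeta>\<close> for the primitive \<open>p\<close>-th root of unity and \<open>\<chi>\<close> for the Legendre symbol. At the
  points \<open>\<zeta>^k\<close> the polynomial has the value \<open>\<chi>(k)\<close> times a Gauss sum of absolute value
  \<open>\<surd>p\<close>, and it is determined by these values. With \<open>t = \<zeta>^(K+x) (1 + i w) / (1 - i w)\<close> and
  \<open>b\<^sub>k = cot (\<pi> (K + x - k) / p)\<close> the interpolation formula becomes
  \<open>f(t) = u (t^p - 1) F(w)\<close>, where \<open>u\<close> is a nonzero constant and
  \<open>F(w) = \<Sum>\<^sub>k \<chi>(k) (b\<^sub>k - w) / (1 + b\<^sub>k w)\<close> is real for real \<open>w\<close>; this is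
  \<open>gauss_mult_fekete_eq_cot_sum\<close>. On the unit circle \<open>f\<close> is therefore \<open>\<surd>p\<close> times
  a phase times the real function \<open>sin (\<pi> x) F(0) / p\<close>, which extends to the ends of the arc
  with the values \<open>\<chi>(K)\<close> and \<open>- \<chi>(K + 1)\<close>.

  If \<open>\<chi>(K) = \<chi>(K + 1)\<close> this real function changes sign, and \<open>f\<close> has a zero on the arc itself.

  Suppose \<open>\<chi>(K + 1) = - \<chi>(K)\<close>. Expanding at the point \<open>x\<close> where \<open>f\<close> is small,
  \<open>F(w) = F(0) - S\<^sub>1 w + S\<^sub>2 w\<^sup>2 - O(w\<^sup>3)\<close> with \<open>S\<^sub>2 = \<Sum>\<^sub>k \<chi>(k) b\<^sub>k (1 + b\<^sub>k\<^sup>2)\<close>. The terms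
  \<open>k = K\<close> and \<open>k = K + 1\<close> of \<open>S\<^sub>2\<close> have the same sign, and together they exceed twice the
  sum of the absolute values of all others; so \<open>\<chi>(K) F\<close> is uniformly convex along the arc
  (\<open>cot_node_estimates\<close>). All estimates are homogeneous in the size \<open>a\<close> of the largest
  \<open>b\<^sub>k\<close>, which makes them uniform in \<open>p\<close> and up to the ends of the arc. After the rescaling
  \<open>w = v / a\<close>, \<open>\<chi>(K) F / a\<close> is a real analytic function with bounded coefficients, second
  coefficient at least \<open>1/2\<close> and value \<open>O(\<epsilon>)\<close> at \<open>0\<close>. Either it has a real zero nearby, or it
  stays positive, which forces its linear coefficient to be \<open>O(\<epsilon>^(1/2))\<close>. Then on a circle
  of radius \<open>\<rho>\<close> comparable to \<open>\<epsilon>^(1/3)\<close> the quadratic term, of order \<open>\<rho>\<^sup>2\<close>, dominates the others,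
  of order \<open>\<epsilon>\<close>, \<open>\<epsilon>^(1/2) \<rho>\<close> and \<open>\<rho>\<^sup>3\<close>, and the maximum principle for \<open>1/F\<close> gives a zero inside
  (\<open>zero_near_almost_double_zero\<close>). The zeros of \<open>F\<close> come in conjugate pairs, which correspond to
  points \<open>t\<close> symmetric in the unit circle, so one of them has \<open>\<bar>t\<bar> \<le> 1\<close>.
\<close>

section \<open>The Legendre symbol as a periodic function\<close>

locale odd_prime =
  fixes p :: nat
  assumes prime_p: "prime p" and odd_p: "odd p"
begin

lemma p_ge_3: "p \<ge> 3"
  using prime_p odd_p prime_ge_2_nat[of p] by (cases "p = 2") auto

lemma p_pos: "p > 0"
  using p_ge_3 by simp

abbreviation chi :: "int \<Rightarrow> int" where
  "chi k \<equiv> Legendre k (int p)"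

lemma chi_cases: "chi k = 0 \<or> chi k = 1 \<or> chi k = -1"
  by (simp add: Legendre_def)

lemma chi_eq_0_iff: "chi k = 0 \<longleftrightarrow> int p dvd k"
  by (simp add: Legendre_def cong_0_iff)

lemma chi_one: "chi 1 = 1"
proof -
  have "\<not> int p dvd 1" using p_ge_3 by simp
  moreover have "QuadRes (int p) 1"
    unfolding QuadRes_def by (rule exI[of _ 1]) simp
  ultimately show ?thesis by (simp add: Legendre_def cong_0_iff)
qed

lemma chi_mod: "chi (k mod int p) = chi k"
  by (simp add: Legendre_def QuadRes_def cong_def)

lemma chi_mult: "chi (a * b) = chi a * chi b"
proof -
  have p2: "2 < p" using p_ge_3 by simp
  let ?e = "(p - 1) div 2"
  have "[chi a * chi b = a ^ ?e * b ^ ?e] (mod int p)"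
    by (intro cong_mult euler_criterion prime_p p2)
  moreover have "[chi (a * b) = (a * b) ^ ?e] (mod int p)"
    by (intro euler_criterion prime_p p2)
  ultimately have "[chi (a * b) = chi a * chi b] (mod int p)"
    by (metis cong_sym cong_trans power_mult_distrib)
  then have dvd: "int p dvd chi (a * b) - chi a * chi b"
    by (simp add: cong_iff_dvd_diff)
  have "\<bar>chi (a * b) - chi a * chi b\<bar> \<le> 2"
    using chi_cases[of a] chi_cases[of b] chi_cases[of "a * b"] by auto
  with dvd p2 show ?thesis
    using dvd_imp_le_int[of "chi (a * b) - chi a * chi b" "int p"] by fastforce
qed

text \<open>
  If every nonzero residue were a square, squaring would permute the nonzero residues; but
  \<open>1\<close> and \<open>-1\<close> have the same square.
\<close>
lemma ex_nonresidue: "\<exists>n. chi n = -1"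
proof (rule ccontr)
  assume "\<nexists>n. chi n = -1"
  let ?A = "{1..<int p}"
  define s where "s y = y ^ 2 mod int p" for y :: int
  have "s ` ?A = ?A"
  proof
    show "s ` ?A \<subseteq> ?A"
    proof safe
      fix y assume y: "y \<in> ?A"
      have "\<not> int p dvd y ^ 2"
        using y prime_p by (metis prime_dvd_power prime_nat_int_transfer
            atLeastLessThan_iff zdvd_not_zless zero_less_one order_less_le_trans)
      then have "s y \<noteq> 0" by (auto simp: s_def)
      moreover have "0 \<le> s y" "s y < int p" using p_pos by (auto simp: s_def)
      ultimately show "s y \<in> ?A" by simp
    qed
    show "?A \<subseteq> s ` ?A"
    proof
      fix a assume a: "a \<in> ?A"
      then have nd: "\<not> int p dvd a" by (auto simp: zdvd_not_zless)
      then have "QuadRes (int p) a"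
        using \<open>\<nexists>n. chi n = -1\<close> by (metis Legendre_def chi_eq_0_iff)
      then obtain y where y: "[y ^ 2 = a] (mod int p)" by (auto simp: QuadRes_def)
      have sa: "s (y mod int p) = a"
        using y a by (simp add: s_def power_mod cong_def)
      have "y mod int p \<noteq> 0"
      proof
        assume "y mod int p = 0"
        with sa a show False by (simp add: s_def)
      qed
      moreover have "0 \<le> y mod int p" "y mod int p < int p" using p_pos by auto
      ultimately have "y mod int p \<in> ?A" by simp
      with sa show "a \<in> s ` ?A" by blast
    qed
  qed
  then have "inj_on s ?A" by (simp add: eq_card_imp_inj_on)
  moreover have "s 1 = s (int p - 1)"
  proof -
    have "[(int p - 1) ^ 2 = (-1) ^ 2] (mod int p)"
      by (intro cong_pow) (simp add: cong_iff_dvd_diff)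
    then show ?thesis by (simp add: s_def cong_def)
  qed
  ultimately have "1 = int p - 1" using p_ge_3 by (auto dest: inj_onD)
  then show False using p_ge_3 by simp
qed

lemma sum_periodic_shift:
  fixes \<psi> :: "int \<Rightarrow> 'a :: comm_monoid_add"
  assumes "\<And>k. \<psi> (k mod int p) = \<psi> k"
  shows "sum \<psi> {M..<M + int p} = sum \<psi> {0..<int p}"
proof (rule sum.reindex_bij_witness[where j = "\<lambda>k. k mod int p"
      and i = "\<lambda>k. M + (k - M) mod int p"])
  fix k assume k: "k \<in> {M..<M + int p}"
  show "M + (k mod int p - M) mod int p = k"
    using k by (simp add: mod_diff_left_eq)
  show "k mod int p \<in> {0..<int p}" using p_pos by simp
  show "\<psi> (k mod int p) = \<psi> k" by (rule assms)
next
  fix k assume k: "k \<in> {0..<int p}"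
  show "(M + (k - M) mod int p) mod int p = k"
    using k by (simp add: mod_add_right_eq)
  show "M + (k - M) mod int p \<in> {M..<M + int p}" using p_pos by simp
qed

lemma sum_periodic_mult:
  fixes \<psi> :: "int \<Rightarrow> 'a :: comm_monoid_add"
  assumes per: "\<And>k. \<psi> (k mod int p) = \<psi> k" and a: "\<not> int p dvd a"
  shows "(\<Sum>k\<in>{0..<int p}. \<psi> (a * k)) = sum \<psi> {0..<int p}"
proof -
  have "inj_on (\<lambda>k. a * k mod int p) {0..<int p}"
  proof (rule inj_onI)
    fix x y assume xy: "x \<in> {0..<int p}" "y \<in> {0..<int p}" "a * x mod int p = a * y mod int p"
    have "coprime a (int p)"
      using a prime_p by (metis coprime_commute prime_imp_coprime prime_nat_int_transfer)
    then have "[x = y] (mod int p)"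
      using xy(3) by (metis cong_def cong_mult_lcancel)
    then show "x = y" using xy by (simp add: cong_def)
  qed
  moreover have "(\<lambda>k. a * k mod int p) ` {0..<int p} \<subseteq> {0..<int p}"
    using p_pos by auto
  ultimately have "bij_betw (\<lambda>k. a * k mod int p) {0..<int p} {0..<int p}"
    by (metis bij_betw_def endo_inj_surj finite_atLeastLessThan_int)
  then have "sum \<psi> {0..<int p} = (\<Sum>k\<in>{0..<int p}. \<psi> (a * k mod int p))"
    by (rule sum.reindex_bij_betw[symmetric])
  then show ?thesis by (simp add: per)
qed

text \<open>Multiplication by a nonresidue permutes the residues and reverses the sign of the sum.\<close>
lemma sum_chi: "(\<Sum>k\<in>{0..<int p}. chi k) = 0"
proof -
  obtain n where n: "chi n = -1" using ex_nonresidue by blast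
  have "(\<Sum>k\<in>{0..<int p}. chi (n * k)) = (\<Sum>k\<in>{0..<int p}. chi k)"
    by (rule sum_periodic_mult) (use n chi_eq_0_iff[of n] in \<open>auto simp: chi_mod\<close>)
  then show ?thesis by (simp add: chi_mult n sum_negf)
qed

end

section \<open>Roots of unity and the Gauss sum\<close>

lemma zeta_pow_cis: "zeta_pow p y = cis (2 * pi * y / real p)"
  by (simp add: zeta_pow_def cis_conv_exp mult_ac)

lemma zeta_pow_add: "zeta_pow p (x + y) = zeta_pow p x * zeta_pow p y"
  by (simp add: zeta_pow_cis cis_mult add_divide_distrib distrib_left)

lemma zeta_pow_minus: "zeta_pow p (- x) = cnj (zeta_pow p x)"
  by (simp add: zeta_pow_cis cis_cnj)

lemma zeta_pow_0: "zeta_pow p 0 = 1"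
  by (simp add: zeta_pow_cis)

lemma zeta_pow_power: "zeta_pow p x ^ n = zeta_pow p (real n * x)"
  using Complex.DeMoivre[of "2 * pi * x / real p" n] by (simp add: zeta_pow_cis mult_ac)

lemma sum_int_nat: "(\<Sum>k\<in>{0..<int n}. g k) = (\<Sum>a<n. g (int a))"
  by (rule sum.reindex_bij_witness[where i = int and j = nat]) auto

context odd_prime
begin

lemma zeta_pow_int_mod: "zeta_pow p (of_int (k mod int p)) = zeta_pow p (of_int k)"
proof -
  have "zeta_pow p (of_int k) = zeta_pow p (real_of_int (k mod int p) + real_of_int (int p * (k div int p)))"
    by (metis mod_mult_div_eq of_int_add)
  also have "\<dots> = zeta_pow p (of_int (k mod int p)) * zeta_pow p (real_of_int (int p * (k div int p)))"
    by (rule zeta_pow_add)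
  also have "zeta_pow p (real_of_int (int p * (k div int p))) = 1"
    using p_pos cis_multiple_2pi[of "real_of_int (k div int p)"] by (simp add: zeta_pow_cis mult_ac)
  finally show ?thesis by simp
qed

lemma zeta_pow_int_cong: "[a = b] (mod int p) \<Longrightarrow> zeta_pow p (of_int a) = zeta_pow p (of_int b)"
  by (metis zeta_pow_int_mod cong_def)

lemma zeta_pow_eq_1_iff: "zeta_pow p (of_int m) = 1 \<longleftrightarrow> int p dvd m"
proof
  assume "int p dvd m"
  then show "zeta_pow p (of_int m) = 1"
    using zeta_pow_int_cong[of m 0] by (simp add: cong_0_iff zeta_pow_0)
next
  assume "zeta_pow p (of_int m) = 1"
  then have "cos (2 * pi * real_of_int m / real p) = 1"
    by (simp add: zeta_pow_cis complex_eq_iff)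
  then obtain n :: int where "2 * pi * real_of_int m / real p = real_of_int n * 2 * pi"
    by (auto simp: cos_one_2pi_int)
  then have "real_of_int m = real_of_int (int p * n)" using p_pos by (simp add: field_simps)
  then have "m = int p * n" by linarith
  then show "int p dvd m" by simp
qed

lemma zeta_pow_orthogonality:
  "(\<Sum>a\<in>{0..<int p}. zeta_pow p (of_int (a * m))) = (if int p dvd m then of_nat p else 0)"
proof -
  let ?z = "zeta_pow p (of_int m)"
  have "(\<Sum>a\<in>{0..<int p}. zeta_pow p (of_int (a * m))) = (\<Sum>a<p. ?z ^ a)"
    by (simp add: sum_int_nat zeta_pow_power)
  also have "\<dots> = (if int p dvd m then of_nat p else 0)"
  proof (cases "int p dvd m")
    case True
    then show ?thesis using zeta_pow_eq_1_iff[of m] by simp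
  next
    case False
    have "?z ^ p = zeta_pow p (of_int (int p * m))" by (simp add: zeta_pow_power)
    also have "\<dots> = 1" using zeta_pow_eq_1_iff[of "int p * m"] by simp
    finally show ?thesis using False zeta_pow_eq_1_iff[of m] by (simp add: geometric_sum)
  qed
  finally show ?thesis .
qed

text \<open>
  The Gauss sum for the conjugate root of unity: this choice makes the expansion of
  \<open>\<chi>\<close> below free of a factor \<open>\<chi>(-1)\<close>.
\<close>
definition gauss :: complex where
  "gauss = (\<Sum>k\<in>{0..<int p}. of_int (chi k) * zeta_pow p (of_int (- k)))"

text \<open>
  Substituting \<open>k \<mapsto> a k\<close> pulls out \<open>\<chi>(a)\<close>; for \<open>a\<close> divisible by \<open>p\<close> both sides vanish because
  \<open>\<chi>\<close> has mean zero. This is the expansion of \<open>\<chi>\<close> in additive characters.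
\<close>
lemma gauss_twist:
  "(\<Sum>k\<in>{0..<int p}. of_int (chi k) * zeta_pow p (of_int (- (a * k)))) = of_int (chi a) * gauss"
proof (cases "int p dvd a")
  case True
  have "(\<Sum>k\<in>{0..<int p}. of_int (chi k) * zeta_pow p (of_int (- (a * k))))
      = (\<Sum>k\<in>{0..<int p}. of_int (chi k) :: complex)"
    by (rule sum.cong[OF refl]) (use True zeta_pow_eq_1_iff in \<open>metis dvd_minus_iff dvd_mult2 mult.right_neutral\<close>)
  also have "\<dots> = of_int (\<Sum>k\<in>{0..<int p}. chi k)" by simp
  finally show ?thesis using True sum_chi chi_eq_0_iff[of a] by simp
next
  case False
  let ?\<psi> = "\<lambda>k. of_int (chi a) * (of_int (chi k) * zeta_pow p (of_int (- k)))"
  have sq: "chi a * (chi a * c) = c" for c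
    using False chi_cases[of a] chi_eq_0_iff[of a] by auto
  have "(\<Sum>k\<in>{0..<int p}. ?\<psi> (a * k)) = sum ?\<psi> {0..<int p}"
  proof (rule sum_periodic_mult[OF _ False])
    fix k
    have "zeta_pow p (of_int (- (k mod int p))) = zeta_pow p (of_int (- k))"
      by (rule zeta_pow_int_cong) (simp add: cong_def mod_minus_eq)
    then show "?\<psi> (k mod int p) = ?\<psi> k" by (simp add: chi_mod)
  qed
  moreover have "?\<psi> (a * k) = of_int (chi k) * zeta_pow p (of_int (- (a * k)))" for k
  proof -
    have "?\<psi> (a * k) = of_int (chi a * (chi a * chi k)) * zeta_pow p (of_int (- (a * k)))"
      by (simp add: chi_mult)
    then show ?thesis by (simp only: sq)
  qed
  ultimately have "(\<Sum>k\<in>{0..<int p}. of_int (chi k) * zeta_pow p (of_int (- (a * k)))) = sum ?\<psi> {0..<int p}"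
    by (simp only:)
  then show ?thesis by (simp only: gauss_def sum_distrib_left)
qed

text \<open>
  Inserting the expansion of \<open>\<chi>(a)\<close> into \<open>cnj gauss\<close> and summing over \<open>a\<close> first leaves only the
  term \<open>k = 1\<close>.
\<close>
lemma gauss_mult_cnj: "gauss * cnj gauss = of_nat p"
proof -
  have "gauss * cnj gauss = (\<Sum>a\<in>{0..<int p}. zeta_pow p (of_int a) * (of_int (chi a) * gauss))"
  proof -
    have "cnj gauss = (\<Sum>a\<in>{0..<int p}. of_int (chi a) * zeta_pow p (of_int a))"
      unfolding gauss_def cnj_sum by (simp add: zeta_pow_minus)
    then show ?thesis by (simp add: sum_distrib_left mult_ac)
  qed
  also have "\<dots> = (\<Sum>a\<in>{0..<int p}. \<Sum>k\<in>{0..<int p}. of_int (chi k) * zeta_pow p (of_int (a * (1 - k))))"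
  proof (rule sum.cong[OF refl])
    fix a
    have "zeta_pow p (of_int a) * zeta_pow p (of_int (- (a * k))) = zeta_pow p (of_int (a * (1 - k)))" for k
      by (simp add: zeta_pow_add[symmetric] algebra_simps)
    then show "zeta_pow p (of_int a) * (of_int (chi a) * gauss)
        = (\<Sum>k\<in>{0..<int p}. of_int (chi k) * zeta_pow p (of_int (a * (1 - k))))"
      unfolding gauss_twist[symmetric] sum_distrib_left mult.left_commute[of "zeta_pow p (of_int a)"]
      by simp
  qed
  also have "\<dots> = (\<Sum>k\<in>{0..<int p}. of_int (chi k) * (\<Sum>a\<in>{0..<int p}. zeta_pow p (of_int (a * (1 - k)))))"
    by (subst sum.swap) (simp add: sum_distrib_left)
  also have "\<dots> = (\<Sum>k\<in>{0..<int p}. if k = 1 then of_nat p else 0)"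
  proof (rule sum.cong[OF refl])
    fix k assume k: "k \<in> {0..<int p}"
    have "int p dvd 1 - k \<longleftrightarrow> k = 1"
    proof
      assume "int p dvd 1 - k"
      moreover have "\<bar>1 - k\<bar> < int p" using k p_ge_3 by auto
      ultimately show "k = 1" using dvd_imp_le_int[of "1 - k" "int p"] by fastforce
    qed simp
    then show "of_int (chi k) * (\<Sum>a\<in>{0..<int p}. zeta_pow p (of_int (a * (1 - k))))
        = (if k = 1 then of_nat p else 0)"
      unfolding zeta_pow_orthogonality by (auto simp: chi_one)
  qed
  also have "\<dots> = of_nat p" using p_ge_3 by simp
  finally show ?thesis .
qed

lemma norm_gauss: "cmod gauss = sqrt (real p)"
proof -
  have "complex_of_real ((cmod gauss)\<^sup>2) = complex_of_real (real p)"
    using gauss_mult_cnj by (simp only: complex_norm_square of_real_of_nat_eq)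
  then have "(cmod gauss)\<^sup>2 = real p" by (simp only: of_real_eq_iff)
  then show ?thesis by (metis norm_ge_zero real_sqrt_unique)
qed

lemma gauss_nonzero: "gauss \<noteq> 0"
  using norm_gauss p_pos by auto

lemma fekete_eq_sum: "fekete p t = (\<Sum>a<p. of_int (chi (int a)) * t ^ a)"
proof -
  have "{0..p-1} = {..<p}" using p_pos by auto
  then show ?thesis by (simp add: fekete_def)
qed

lemma fekete_zeta_pow_int: "fekete p (zeta_pow p (of_int k)) = of_int (chi k) * cnj gauss"
proof -
  have "of_int (chi k) * cnj gauss = cnj (of_int (chi k) * gauss)" by simp
  also have "\<dots> = (\<Sum>a\<in>{0..<int p}. of_int (chi a) * zeta_pow p (of_int (k * a)))"
    unfolding gauss_twist[symmetric] by (simp add: cnj_sum zeta_pow_minus)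
  also have "\<dots> = fekete p (zeta_pow p (of_int k))"
    unfolding sum_int_nat fekete_eq_sum
    by (intro sum.cong refl) (simp add: zeta_pow_power mult.commute[of "real_of_int k"])
  finally show ?thesis by simp
qed

text \<open>Replacing each coefficient by its character expansion turns \<open>f\<close> into a sum of geometric sums.\<close>
lemma gauss_mult_fekete:
  "gauss * fekete p t = (\<Sum>k\<in>{0..<int p}. of_int (chi k) * (\<Sum>a<p. (zeta_pow p (of_int (- k)) * t) ^ a))"
proof -
  have "gauss * fekete p t = (\<Sum>a<p. (of_int (chi (int a)) * gauss) * t ^ a)"
    unfolding fekete_eq_sum sum_distrib_left by (intro sum.cong refl) (simp only: mult_ac)
  also have "\<dots> = (\<Sum>a<p. \<Sum>k\<in>{0..<int p}. of_int (chi k) * (zeta_pow p (of_int (- k)) * t) ^ a)"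
    unfolding gauss_twist[symmetric] sum_distrib_right
    by (intro sum.cong refl) (simp add: power_mult_distrib zeta_pow_power)
  also have "\<dots> = (\<Sum>k\<in>{0..<int p}. of_int (chi k) * (\<Sum>a<p. (zeta_pow p (of_int (- k)) * t) ^ a))"
    by (subst sum.swap) (simp add: sum_distrib_left)
  finally show ?thesis .
qed

end

section \<open>Interpolation in the cotangent coordinate\<close>

lemma cis_double_eq_cot_quotient:
  assumes "sin \<beta> \<noteq> 0"
  shows "cis (2 * \<beta>) = (of_real (cot \<beta>) + \<i>) / (of_real (cot \<beta>) - \<i>)"
proof -
  have ne: "of_real (cot \<beta>) - \<i> \<noteq> 0" by (auto simp: complex_eq_iff)
  have "cis (2 * \<beta>) * (of_real (cos \<beta>) - \<i> * of_real (sin \<beta>)) = of_real (cos \<beta>) + \<i> * of_real (sin \<beta>)"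
  proof -
    have "cis (2 * \<beta>) * cis (- \<beta>) = cis \<beta>" by (simp add: cis_mult)
    moreover have "cis (- \<beta>) = of_real (cos \<beta>) - \<i> * of_real (sin \<beta>)"
      "cis \<beta> = of_real (cos \<beta>) + \<i> * of_real (sin \<beta>)"
      by (simp_all add: complex_eq_iff)
    ultimately show ?thesis by simp
  qed
  moreover have "of_real (cos \<beta>) = of_real (cot \<beta>) * (of_real (sin \<beta>) :: complex)"
    using assms by (simp add: cot_def)
  ultimately have "of_real (sin \<beta>) * (cis (2 * \<beta>) * (of_real (cot \<beta>) - \<i>))
      = of_real (sin \<beta>) * (of_real (cot \<beta>) + \<i>)"
    by (simp add: algebra_simps)
  then have "cis (2 * \<beta>) * (of_real (cot \<beta>) - \<i>) = of_real (cot \<beta>) + \<i>"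
    using assms by simp
  then show ?thesis using ne by (simp add: field_simps)
qed

text \<open>
  The Cayley transform turns rotations of the circle into Moebius maps of the cotangent
  coordinate: \<open>q\<close> is the Cayley transform of \<open>(b - w) / (1 + b w)\<close>, the cotangent of the sum of
  the angles with cotangent \<open>b\<close> and tangent \<open>w\<close>. The kernel \<open>1 / (q - 1)\<close> of the interpolation
  formula is thus affine in this coordinate.
\<close>
lemma cot_quotient_minus_one:
  fixes b :: real and w :: complex
  assumes w: "1 - \<i> * w \<noteq> 0" and bw: "1 + of_real b * w \<noteq> 0"
  defines "q \<equiv> (of_real b + \<i>) / (of_real b - \<i>) * ((1 + \<i> * w) / (1 - \<i> * w))"
  shows "q \<noteq> 1"
    and "1 / (q - 1) = - 1 / 2 - \<i> / 2 * ((of_real b - w) / (1 + of_real b * w))"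
proof -
  have b: "of_real b - \<i> \<noteq> 0" by (auto simp: complex_eq_iff)
  have q: "q - 1 = 2 * \<i> * (1 + of_real b * w) / ((of_real b - \<i>) * (1 - \<i> * w))"
    using w b by (simp add: q_def divide_simps) (simp add: algebra_simps)
  have "q - 1 \<noteq> 0" unfolding q using w b bw by simp
  then show "q \<noteq> 1" by simp
  show "1 / (q - 1) = - 1 / 2 - \<i> / 2 * ((of_real b - w) / (1 + of_real b * w))"
  proof -
    let ?D = "1 + of_real b * w"
    have "1 / (q - 1) = (of_real b - \<i>) * (1 - \<i> * w) / (2 * \<i> * ?D)"
      unfolding q by simp
    also have "(of_real b - \<i>) * (1 - \<i> * w) = \<i> * (- ?D - \<i> * (of_real b - w))"
      by (simp add: algebra_simps)
    also have "\<dots> / (2 * \<i> * ?D) = (- ?D - \<i> * (of_real b - w)) / (2 * ?D)"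
      by simp
    also have "\<dots> = - ?D / (2 * ?D) - \<i> * (of_real b - w) / (2 * ?D)"
      by (rule diff_divide_distrib)
    also have "- ?D / (2 * ?D) = - 1 / 2"
      using nonzero_mult_divide_mult_cancel_right[OF bw, of "- 1" 2] by simp
    finally show ?thesis by simp
  qed
qed

context odd_prime
begin

text \<open>The cotangent of half the angle from \<open>\<zeta>^k\<close> to \<open>\<zeta>^(K+x)\<close>.\<close>
definition cot_node :: "int \<Rightarrow> real \<Rightarrow> int \<Rightarrow> real" where
  "cot_node K x k = cot (pi * (of_int (K - k) + x) / real p)"

text \<open>
  The window of summation may start at any \<open>M\<close>, so that later it can be centred at the arc. The
  geometric sum with ratio \<open>\<zeta>^(-k) t\<close> is \<open>t^p - 1\<close> times the kernel computed in
  \<open>cot_quotient_minus_one\<close>, and the constant \<open>-1/2\<close> of that kernel disappears because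
  \<open>\<chi>\<close> has mean zero.
\<close>
lemma gauss_mult_fekete_eq_cot_sum:
  fixes K M :: int and x :: real and w :: complex
  assumes x: "0 < x" "x < 1"
    and w: "1 - \<i> * w \<noteq> 0"
    and bw: "\<And>k. k \<in> {M..<M + int p} \<Longrightarrow> 1 + of_real (cot_node K x k) * w \<noteq> 0"
  defines "t \<equiv> zeta_pow p (of_int K + x) * ((1 + \<i> * w) / (1 - \<i> * w))"
  shows "gauss * fekete p t = - (\<i> / 2) * (t ^ p - 1) *
    (\<Sum>k\<in>{M..<M + int p}. of_int (chi k) * ((of_real (cot_node K x k) - w) / (1 + of_real (cot_node K x k) * w)))"
proof -
  let ?X = "\<lambda>k. (of_real (cot_node K x k) - w) / (1 + of_real (cot_node K x k) * w)"
  let ?\<psi> = "\<lambda>k. of_int (chi k) * (\<Sum>a<p. (zeta_pow p (of_int (- k)) * t) ^ a)"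
  have per: "?\<psi> (k mod int p) = ?\<psi> k" for k
  proof -
    have "zeta_pow p (of_int (- (k mod int p))) = zeta_pow p (of_int (- k))"
      by (rule zeta_pow_int_cong) (simp add: cong_def mod_minus_eq)
    then show ?thesis by (simp add: chi_mod)
  qed
  have geo: "(\<Sum>a<p. (zeta_pow p (of_int (- k)) * t) ^ a) = (t ^ p - 1) * (- 1 / 2 - \<i> / 2 * ?X k)"
    if k: "k \<in> {M..<M + int p}" for k
  proof -
    let ?\<beta> = "pi * (of_int (K - k) + x) / real p"
    let ?q = "zeta_pow p (of_int (- k)) * t"
    \<comment> \<open>\<open>x\<close> is not an integer, so \<open>\<zeta>^(K+x)\<close> is not a \<open>p\<close>-th root of unity\<close>
    have "sin ?\<beta> \<noteq> 0"
    proof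
      assume "sin ?\<beta> = 0"
      then obtain i :: int where "?\<beta> = of_int i * pi" by (auto simp: sin_zero_iff_int2)
      then have "pi * (of_int (K - k) + x) = pi * of_int (i * int p)" using p_pos by (simp add: field_simps)
      then have "of_int (K - k) + x = of_int (i * int p)" using pi_neq_zero by (metis mult_cancel_left)
      then have "x = of_int (i * int p - (K - k))" by simp
      then have "0 < i * int p - (K - k)" "i * int p - (K - k) < 1"
        using x by (simp_all only: of_int_0_less_iff of_int_less_1_iff)
      then show False by simp
    qed
    then have "cis (2 * ?\<beta>) = (of_real (cot_node K x k) + \<i>) / (of_real (cot_node K x k) - \<i>)"
      unfolding cot_node_def by (rule cis_double_eq_cot_quotient)
    moreover have "zeta_pow p (of_int (- k)) * zeta_pow p (of_int K + x) = cis (2 * ?\<beta>)"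
      by (simp add: zeta_pow_add[symmetric]) (simp add: zeta_pow_cis algebra_simps)
    ultimately have q: "?q = (of_real (cot_node K x k) + \<i>) / (of_real (cot_node K x k) - \<i>)
        * ((1 + \<i> * w) / (1 - \<i> * w))"
      by (simp add: t_def mult.assoc[symmetric])
    have "zeta_pow p (of_int (- k)) ^ p = 1"
      using zeta_pow_eq_1_iff[of "int p * (- k)"] by (simp add: zeta_pow_power)
    then have qp: "?q ^ p = t ^ p" by (simp add: power_mult_distrib)
    have "?q \<noteq> 1" unfolding q by (rule cot_quotient_minus_one(1)[OF w bw[OF k]])
    then have "(\<Sum>a<p. ?q ^ a) = (t ^ p - 1) * (1 / (?q - 1))"
      using geometric_sum[of ?q p] unfolding qp by simp
    moreover have "1 / (?q - 1) = - 1 / 2 - \<i> / 2 * ?X k"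
      unfolding q by (rule cot_quotient_minus_one(2)[OF w bw[OF k]])
    ultimately show ?thesis by (simp only:)
  qed
  have chi0: "(\<Sum>k\<in>{M..<M + int p}. of_int (chi k) :: complex) = 0"
    using sum_periodic_shift[of chi M] chi_mod sum_chi by (metis of_int_0 of_int_sum)
  have "gauss * fekete p t = sum ?\<psi> {M..<M + int p}"
    unfolding gauss_mult_fekete by (rule sum_periodic_shift[of ?\<psi> M, OF per, symmetric])
  also have "\<dots> = (\<Sum>k\<in>{M..<M + int p}. (t ^ p - 1) * (- 1 / 2) * of_int (chi k)
      + - (\<i> / 2) * (t ^ p - 1) * (of_int (chi k) * ?X k))"
  proof (rule sum.cong[OF refl])
    have distrib: "c * (T * (- 1 / 2 - \<i> / 2 * X)) = T * (- 1 / 2) * c + - (\<i> / 2) * T * (c * X)"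
      for c T X :: complex
      by (simp add: algebra_simps)
    fix k assume "k \<in> {M..<M + int p}"
    then show "?\<psi> k = (t ^ p - 1) * (- 1 / 2) * of_int (chi k) + - (\<i> / 2) * (t ^ p - 1) * (of_int (chi k) * ?X k)"
      by (simp only: geo distrib)
  qed
  also have "\<dots> = (t ^ p - 1) * (- 1 / 2) * (\<Sum>k\<in>{M..<M + int p}. of_int (chi k))
      + - (\<i> / 2) * (t ^ p - 1) * (\<Sum>k\<in>{M..<M + int p}. of_int (chi k) * ?X k)"
    by (simp only: sum.distrib sum_distrib_left)
  finally show ?thesis using chi0 by simp
qed

end

section \<open>Cotangents along an arithmetic progression\<close>

lemma cot_diff:
  fixes \<alpha> h :: real
  assumes "sin \<alpha> \<noteq> 0" "sin (\<alpha> + h) \<noteq> 0"  "sin h \<noteq> 0"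
  shows "(cot \<alpha> - cot (\<alpha> + h)) * cot h = 1 + cot \<alpha> * cot (\<alpha> + h)"
proof -
  have h: "sin h = sin (\<alpha> + h) * cos \<alpha> - cos (\<alpha> + h) * sin \<alpha>"
    using sin_diff[of "\<alpha> + h" \<alpha>] by simp
  have c: "cos h = cos (\<alpha> + h) * cos \<alpha> + sin (\<alpha> + h) * sin \<alpha>"
    using cos_diff[of "\<alpha> + h" \<alpha>] by simp
  have "(cot \<alpha> - cot (\<alpha> + h)) * (sin \<alpha> * sin (\<alpha> + h)) = sin h"
    using assms unfolding h by (simp add: cot_def field_simps)
  moreover have "(1 + cot \<alpha> * cot (\<alpha> + h)) * (sin \<alpha> * sin (\<alpha> + h)) = cos h"
    using assms unfolding c by (simp add: cot_def field_simps)
  moreover have "sin h * cot h = cos h" using assms(3) by (simp add: cot_def)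
  ultimately have "(cot \<alpha> - cot (\<alpha> + h)) * cot h * (sin \<alpha> * sin (\<alpha> + h)) =
      (1 + cot \<alpha> * cot (\<alpha> + h)) * (sin \<alpha> * sin (\<alpha> + h))"
    by (metis mult.assoc mult.commute)
  then show ?thesis using assms by simp
qed

lemma cot_nonneg:
  fixes a :: real
  assumes "0 < a" "a \<le> pi / 2"
  shows "0 \<le> cot a"
  unfolding cot_def using assms by (intro divide_nonneg_nonneg cos_ge_zero sin_ge_zero) auto

lemma cot_antimono:
  fixes a b :: real
  assumes "0 < a" "a \<le> b" "b \<le> pi / 2"
  shows "cot b \<le> cot a"
proof (cases "b = pi / 2 \<or> a = b")
  case True
  then show ?thesis
  proof
    assume "b = pi / 2"
    then have "cot b = 0" by (simp only: cot_def cos_pi_half div_0)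
    moreover have "0 \<le> cot a" using assms by (intro cot_nonneg) auto
    ultimately show ?thesis by linarith
  qed simp
next
  case False
  then have "0 < tan a" "tan a \<le> tan b"
    using assms by (auto intro: tan_gt_zero tan_mono_le)
  then show ?thesis unfolding cot_altdef by (intro le_imp_inverse_le)
qed

text \<open>
  Both sums telescope. For consecutive members \<open>A \<ge> B \<ge> 0\<close> the difference formula reads
  \<open>1 + A B = (A - B) cot h\<close>, whence \<open>1 + B\<^sup>2 \<le> (A - B) cot h\<close> and
  \<open>2 B (1 + B\<^sup>2) \<le> (A + B) (1 + A B) = (A\<^sup>2 - B\<^sup>2) cot h\<close>. Because \<open>y \<le> h\<close>, the factor
  \<open>cot h\<close> is at most the first member of the progression. The factor \<open>1/2\<close> in the second bound
  is what makes the two nodes next to the arc outweigh all the others.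
\<close>
lemma cot_progression_sums:
  fixes y h :: real and n :: nat
  assumes y: "0 < y" "y \<le> h" and h: "h < pi / 2" and n: "y + real n * h \<le> pi / 2"
  defines "B \<equiv> \<lambda>i::nat. cot (y + real i * h)"
  shows "(\<Sum>i=1..n. 1 + (B i)\<^sup>2) \<le> (B 0)\<^sup>2"
    and "(\<Sum>i=1..n. B i * (1 + (B i)\<^sup>2)) \<le> (B 0) ^ 3 / 2"
proof -
  have arg: "0 < y + real i * h \<and> y + real i * h \<le> pi / 2" if "i \<le> n" for i
  proof -
    have "real i * h \<le> real n * h" using that y by (intro mult_right_mono) auto
    moreover have "0 \<le> real i * h" using y by simp
    ultimately show ?thesis using y n by linarith
  qed
  have pos: "0 \<le> B i" if "i \<le> n" for i
    unfolding B_def using arg[OF that] by (intro cot_nonneg) auto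
  have C: "0 < cot h" "cot h \<le> B 0"
    using y h by (auto simp: B_def intro!: cot_antimono cot_gt_zero)
  have step: "(B i - B (Suc i)) * cot h = 1 + B i * B (Suc i)" "B (Suc i) \<le> B i" if "i < n" for i
  proof -
    have "sin (y + real i * h) > 0" "sin (y + real (Suc i) * h) > 0" "sin h > 0"
      using arg[of i] arg[of "Suc i"] that y h by (auto intro!: sin_gt_zero)
    then show *: "(B i - B (Suc i)) * cot h = 1 + B i * B (Suc i)"
      using cot_diff[of "y + real i * h" h] by (simp add: B_def algebra_simps)
    have "0 \<le> B i * B (Suc i)" using pos that by simp
    then have "0 < (B i - B (Suc i)) * cot h" using * by simp
    then show "B (Suc i) \<le> B i" using C by (simp add: zero_less_mult_iff)
  qed
  have s1: "(\<Sum>i=1..k. 1 + (B i)\<^sup>2) \<le> (B 0 - B k) * cot h" if "k \<le> n" for k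
    using that
  proof (induction k)
    case (Suc k)
    have "B (Suc k) * B (Suc k) \<le> B k * B (Suc k)"
      using step(2)[of k] pos[of "Suc k"] Suc.prems by (intro mult_right_mono) auto
    then have "1 + (B (Suc k))\<^sup>2 \<le> (B k - B (Suc k)) * cot h"
      using step(1)[of k] Suc.prems by (simp add: power2_eq_square)
    moreover have "(\<Sum>i=1..Suc k. 1 + (B i)\<^sup>2) = (\<Sum>i=1..k. 1 + (B i)\<^sup>2) + (1 + (B (Suc k))\<^sup>2)"
      by simp
    ultimately show ?case using Suc by (simp add: algebra_simps)
  qed simp
  have s2: "(\<Sum>i=1..k. B i * (1 + (B i)\<^sup>2)) \<le> ((B 0)\<^sup>2 - (B k)\<^sup>2) * cot h / 2" if "k \<le> n" for k
    using that
  proof (induction k)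
    case (Suc k)
    have le: "B (Suc k) \<le> B k" "0 \<le> B (Suc k)" "0 \<le> B k"
      using step(2)[of k] pos Suc.prems by auto
    have "(2 * B (Suc k)) * (1 + B (Suc k) * B (Suc k)) \<le> (B k + B (Suc k)) * (1 + B k * B (Suc k))"
      using le by (intro mult_mono add_mono) auto
    also have "\<dots> = (B k + B (Suc k)) * (B k - B (Suc k)) * cot h"
      using step(1)[of k] Suc.prems by (simp add: mult.assoc)
    also have "\<dots> = ((B k)\<^sup>2 - (B (Suc k))\<^sup>2) * cot h"
      by (simp add: power2_eq_square algebra_simps)
    finally have "B (Suc k) * (1 + (B (Suc k))\<^sup>2) \<le> ((B k)\<^sup>2 - (B (Suc k))\<^sup>2) * cot h / 2"
      by (simp add: power2_eq_square)
    moreover have "(\<Sum>i=1..Suc k. B i * (1 + (B i)\<^sup>2)) = (\<Sum>i=1..k. B i * (1 + (B i)\<^sup>2)) + B (Suc k) * (1 + (B (Suc k))\<^sup>2)"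
      by simp
    ultimately show ?case using Suc by (simp add: algebra_simps diff_divide_distrib)
  qed simp
  have "(\<Sum>i=1..n. 1 + (B i)\<^sup>2) \<le> (B 0 - B n) * cot h" by (rule s1) simp
  also have "\<dots> \<le> B 0 * B 0" using C pos[of n] by (intro mult_mono) auto
  finally show "(\<Sum>i=1..n. 1 + (B i)\<^sup>2) \<le> (B 0)\<^sup>2" by (simp add: power2_eq_square)
  have "(\<Sum>i=1..n. B i * (1 + (B i)\<^sup>2)) \<le> ((B 0)\<^sup>2 - (B n)\<^sup>2) * cot h / 2" by (rule s2) simp
  also have "((B 0)\<^sup>2 - (B n)\<^sup>2) * cot h \<le> (B 0)\<^sup>2 * B 0" using C by (intro mult_mono) auto
  finally show "(\<Sum>i=1..n. B i * (1 + (B i)\<^sup>2)) \<le> (B 0) ^ 3 / 2"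
    by (simp add: power2_eq_square power3_eq_cube)
qed


lemma cot_ge_reciprocal:
  fixes u :: real
  assumes "0 < u" "u \<le> pi / 3"
  shows "1 / (2 * u) \<le> cot u"
proof -
  have "cos (pi / 3) \<le> cos u" using assms by (intro cos_monotone_0_pi_le) auto
  then have "1 / 2 \<le> cos u" by (simp add: cos_60)
  moreover have "0 < sin u" "sin u \<le> u" using assms by (auto intro: sin_gt_zero sin_x_le_x)
  ultimately have "(1 / 2) / u \<le> cos u / sin u" by (intro frac_le) auto
  then show ?thesis by (simp add: cot_def)
qed

lemma sum_around_arc:
  fixes g :: "int \<Rightarrow> 'a :: comm_monoid_add"
  assumes "l + m + 2 = n"
  shows "sum g {K - int l..<K - int l + int n} =
    g K + g (K + 1) + ((\<Sum>i=1..l. g (K - int i)) + (\<Sum>i=1..m. g (K + 1 + int i)))"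
proof -
  let ?L = "(\<lambda>i. K - int i) ` {1..l}" and ?R = "(\<lambda>i. K + 1 + int i) ` {1..m}"
  have L: "?L = {K - int l..<K}"
  proof
    show "{K - int l..<K} \<subseteq> ?L"
    proof
      fix k assume "k \<in> {K - int l..<K}"
      then show "k \<in> ?L" by (intro image_eqI[of _ _ "nat (K - k)"]) auto
    qed
  qed auto
  have R: "?R = {K + 2..<K + 2 + int m}"
  proof
    show "{K + 2..<K + 2 + int m} \<subseteq> ?R"
    proof
      fix k assume "k \<in> {K + 2..<K + 2 + int m}"
      then show "k \<in> ?R" by (intro image_eqI[of _ _ "nat (k - K - 1)"]) auto
    qed
  qed auto
  have "{K - int l..<K - int l + int n} = {K, K + 1} \<union> (?L \<union> ?R)"
    unfolding L R using assms by auto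
  moreover have "{K, K + 1} \<inter> (?L \<union> ?R) = {}" "?L \<inter> ?R = {}"
    unfolding L R by auto
  ultimately have "sum g {K - int l..<K - int l + int n} = sum g {K, K + 1} + (sum g ?L + sum g ?R)"
    by (simp add: sum.union_disjoint add.assoc)
  moreover have "sum g ?L = (\<Sum>i=1..l. g (K - int i))" "sum g ?R = (\<Sum>i=1..m. g (K + 1 + int i))"
    by (subst sum.reindex; simp add: inj_on_def)+
  ultimately show ?thesis by simp
qed

context odd_prime
begin

text \<open>
  The window consists of \<open>l\<close> points to the left of \<open>K\<close> and \<open>m\<close> points to the right of \<open>K + 1\<close>,
  chosen such that the way from \<open>\<zeta>^(K+x)\<close> to each of them, on its own side, is at most half a
  turn. The absolute values of the
  nodes then form two progressions as in \<open>cot_progression_sums\<close>, starting at the ends of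
  the arc. In the last estimate the two ends contribute \<open>L + L\<^sup>3\<close> and \<open>R + R\<^sup>3\<close>, where
  \<open>L\<close> and \<open>- R\<close> are their nodes, while the rest is at most \<open>(L\<^sup>3 + R\<^sup>3) / 2\<close>
  whatever the signs are.
\<close>
lemma cot_node_estimates:
  fixes K :: int and x :: real
  assumes x: "0 < x" "x < 1"
  obtains a :: real and M :: int where
    "1 \<le> a"
    "real p \<le> 2 * pi * a * min x (1 - x)"
    "\<And>k. k \<in> {M..<M + int p} \<Longrightarrow> \<bar>cot_node K x k\<bar> \<le> a"
    "(\<Sum>k\<in>{M..<M + int p}. 1 + (cot_node K x k)\<^sup>2) \<le> 6 * a\<^sup>2"
    "\<And>c :: int \<Rightarrow> real. c K = 1 \<Longrightarrow> c (K + 1) = -1 \<Longrightarrow> (\<And>k. \<bar>c k\<bar> \<le> 1) \<Longrightarrow>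
      a ^ 3 / 2 \<le> (\<Sum>k\<in>{M..<M + int p}. c k * (cot_node K x k * (1 + (cot_node K x k)\<^sup>2)))"
proof -
  let ?b = "cot_node K x"
  obtain n where n: "p = 2 * n + 1" using odd_p by (auto elim: oddE)
  have n1: "n \<ge> 1" using p_ge_3 n by simp
  \<comment> \<open>the point opposite to the arc goes to the side of the nearer end\<close>
  define l where "l = (if x \<le> 1 / 2 then n else n - 1)"
  define m where "m = (if x \<le> 1 / 2 then n - 1 else n)"
  have lm: "l + m + 2 = p" using n n1 by (auto simp: l_def m_def)
  define h where "h = pi / real p"
  have h: "0 < h" "h \<le> pi / 3" "real p * h = pi"
    using p_ge_3 by (auto simp: h_def field_simps)
  define L where "L i = cot (x * h + real i * h)" for i :: nat
  define R where "R i = cot ((1 - x) * h + real i * h)" for i :: nat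
  have reach: "x * h + real l * h \<le> pi / 2" "(1 - x) * h + real m * h \<le> pi / 2"
  proof -
    have "(x + real l) * 2 \<le> real p" "(1 - x + real m) * 2 \<le> real p"
      using n n1 x by (auto simp: l_def m_def of_nat_diff)
    then have "(x + real l) * 2 * h \<le> real p * h" "(1 - x + real m) * 2 * h \<le> real p * h"
      using h(1) by (simp_all only: mult_right_mono order_less_imp_le)
    then show "x * h + real l * h \<le> pi / 2" "(1 - x) * h + real m * h \<le> pi / 2"
      unfolding h(3) by (auto simp: algebra_simps)
  qed
  have xh: "0 < x * h" "x * h \<le> h" "0 < (1 - x) * h" "(1 - x) * h \<le> h" "h < pi / 2"
    using x h pi_gt_zero by (auto simp: mult_le_cancel_right1 simp del: pi_gt_zero)
  note sL = cot_progression_sums[OF xh(1,2,5) reach(1), folded L_def]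
  note sR = cot_progression_sums[OF xh(3,4,5) reach(2), folded R_def]
  have nodes: "?b K = L 0" "?b (K + 1) = - R 0"
    "?b (K - int i) = L i" "?b (K + 1 + int i) = - R i" for i
  proof -
    show bL: "?b (K - int i) = L i" for i
      by (simp add: cot_node_def L_def h_def algebra_simps add_divide_distrib)
    show bR: "?b (K + 1 + int i) = - R i" for i
    proof -
      have "pi * (of_int (K - (K + 1 + int i)) + x) / real p = - ((1 - x) * h + real i * h)"
        by (simp add: h_def algebra_simps add_divide_distrib diff_divide_distrib)
      then show ?thesis by (simp only: cot_node_def R_def cot_minus)
    qed
    show "?b K = L 0" "?b (K + 1) = - R 0" using bL[of 0] bR[of 0] by auto
  qed
  have LR0: "0 < L 0" "0 < R 0"
  proof -
    have "x * h < pi / 2" "(1 - x) * h < pi / 2" using xh by linarith+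
    then have "0 < cot (x * h)" "0 < cot ((1 - x) * h)" using xh(1,3) by (simp_all only: cot_gt_zero)
    then show "0 < L 0" "0 < R 0" by (simp_all add: L_def R_def)
  qed
  have L: "0 \<le> L i \<and> L i \<le> L 0" if "i \<le> l" for i
  proof -
    have "real i * h \<le> real l * h" "0 \<le> real i * h" using that h by (auto intro: mult_right_mono)
    then have "0 < x * h + real i * h" "x * h + real i * h \<le> pi / 2" "x * h \<le> x * h + real i * h"
      using reach xh by linarith+
    then have "0 \<le> cot (x * h + real i * h)" "cot (x * h + real i * h) \<le> cot (x * h)"
      using xh(1) cot_nonneg cot_antimono by blast+
    then show ?thesis by (simp add: L_def)
  qed
  have R: "0 \<le> R i \<and> R i \<le> R 0" if "i \<le> m" for i
  proof -
    have "real i * h \<le> real m * h" "0 \<le> real i * h" using that h by (auto intro: mult_right_mono)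
    then have "0 < (1 - x) * h + real i * h" "(1 - x) * h + real i * h \<le> pi / 2" "(1 - x) * h \<le> (1 - x) * h + real i * h"
      using reach xh by linarith+
    then have "0 \<le> cot ((1 - x) * h + real i * h)" "cot ((1 - x) * h + real i * h) \<le> cot ((1 - x) * h)"
      using xh(3) cot_nonneg cot_antimono by blast+
    then show ?thesis by (simp add: R_def)
  qed
  define a where "a = max (L 0) (R 0)"
  let ?J = "{K - int l..<K - int l + int p}"
  let ?u = "min x (1 - x) * h"
  have "0 < min x (1 - x)" "min x (1 - x) \<le> 1 / 2" using x by (auto simp: min_def)
  then have u: "0 < ?u" "?u \<le> 1 / 2 * h" using h by (auto intro!: mult_right_mono mult_pos_pos simp del: min_less_iff_conj)
  have u': "?u \<le> pi / 4" "?u \<le> pi / 3" using u(2) h(2) pi_gt_zero by linarith+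
  have au: "cot ?u \<le> a" by (auto simp: a_def L_def R_def min_def)
  have "cot (pi / 4) \<le> cot ?u" using u(1) u'(1) by (intro cot_antimono) auto
  then have a1: "1 \<le> a" using au by (simp add: cot_def cos_45 sin_45)
  have ap: "real p \<le> 2 * pi * a * min x (1 - x)"
  proof -
    have "1 / (2 * ?u) \<le> a" using cot_ge_reciprocal[OF u(1) u'(2)] au by linarith
    then have "1 \<le> a * (2 * ?u)" using u by (simp add: field_simps)
    then have "real p * 1 \<le> real p * (a * (2 * ?u))" by (intro mult_left_mono) auto
    also have "\<dots> = 2 * (real p * h) * a * min x (1 - x)" by (simp add: mult_ac)
    finally show ?thesis unfolding h(3) by simp
  qed
  have ba: "\<bar>?b k\<bar> \<le> a" if "k \<in> ?J" for k
  proof (cases "k \<le> K")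
    case True
    then have "\<bar>?b k\<bar> = \<bar>L (nat (K - k))\<bar>" "nat (K - k) \<le> l"
      using nodes(3)[of "nat (K - k)"] that by auto
    moreover have "L 0 \<le> a" by (simp add: a_def)
    ultimately show ?thesis using L[of "nat (K - k)"] by linarith
  next
    case False
    then have "\<bar>?b k\<bar> = \<bar>R (nat (k - K - 1))\<bar>" "nat (k - K - 1) \<le> m"
      using nodes(4)[of "nat (k - K - 1)"] that lm by auto
    moreover have "R 0 \<le> a" by (simp add: a_def)
    ultimately show ?thesis using R[of "nat (k - K - 1)"] by linarith
  qed
  have sq: "(L 0)\<^sup>2 \<le> a\<^sup>2" "(R 0)\<^sup>2 \<le> a\<^sup>2" "1 \<le> a\<^sup>2"
    using LR0 a1 by (auto simp: a_def intro!: power_mono)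
  have s1: "(\<Sum>k\<in>?J. 1 + (?b k)\<^sup>2) \<le> 6 * a\<^sup>2"
    unfolding sum_around_arc[OF lm] nodes power2_minus using sL(1) sR(1) sq by linarith
  have s2: "a ^ 3 / 2 \<le> (\<Sum>k\<in>?J. c k * (?b k * (1 + (?b k)\<^sup>2)))"
    if c: "c K = 1" "c (K + 1) = -1" "\<And>k. \<bar>c k\<bar> \<le> 1" for c :: "int \<Rightarrow> real"
  proof -
    have low: "- y \<le> c k * z" if "\<bar>z\<bar> \<le> y" for k z y
    proof -
      have "\<bar>c k\<bar> * \<bar>z\<bar> \<le> 1 * y" using c(3) that by (intro mult_mono) auto
      then show ?thesis by (simp add: abs_mult[symmetric])
    qed
    have "(\<Sum>i=1..l. - (L i * (1 + (L i)\<^sup>2))) \<le> (\<Sum>i=1..l. c (K - int i) * (L i * (1 + (L i)\<^sup>2)))"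
      using L by (intro sum_mono low) (auto simp: abs_mult)
    then have left: "- ((L 0) ^ 3 / 2) \<le> (\<Sum>i=1..l. c (K - int i) * (L i * (1 + (L i)\<^sup>2)))"
      using sL(2) by (simp add: sum_negf)
    have "(\<Sum>i=1..m. - (R i * (1 + (R i)\<^sup>2))) \<le> (\<Sum>i=1..m. c (K + 1 + int i) * (- R i * (1 + (R i)\<^sup>2)))"
      using R by (intro sum_mono low) (auto simp: abs_mult)
    then have right: "- ((R 0) ^ 3 / 2) \<le> (\<Sum>i=1..m. c (K + 1 + int i) * (- R i * (1 + (R i)\<^sup>2)))"
      using sR(2) by (simp only: sum_negf)
    have "a ^ 3 \<le> (L 0) ^ 3 + (R 0) ^ 3" using LR0 by (auto simp: a_def max_def)
    moreover have "c K * (L 0 * (1 + (L 0)\<^sup>2)) = L 0 + (L 0) ^ 3"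
      "c (K + 1) * (- R 0 * (1 + (R 0)\<^sup>2)) = R 0 + (R 0) ^ 3"
      using c by (simp_all add: algebra_simps power2_eq_square power3_eq_cube)
    ultimately show ?thesis
      unfolding sum_around_arc[OF lm] nodes power2_minus using left right LR0 by linarith
  qed
  show thesis by (rule that[OF a1 ap ba s1 s2])
qed

end

section \<open>Zeros near an almost double zero\<close>

text \<open>
  The parameter \<open>e\<close> plays the role of \<open>\<epsilon>^(1/6)\<close>, so that \<open>\<epsilon>\<close>, \<open>\<epsilon>^(1/2)\<close> and \<open>\<epsilon>^(1/3)\<close> are integral
  powers of it. If the value of \<open>q\<close> at some point of the real segment of radius
  \<open>\<rho> = e\<^sup>2 / 32\<close> is not positive, convexity makes it positive at one of the ends of the
  segment, and there is a real zero. Otherwise positivity at \<open>\<plusminus> e\<^sup>3\<close> bounds the linear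
  coefficient, as for the discriminant of a positive quadratic, and on the circle of radius \<open>\<rho>\<close>
  the quadratic term dominates, so that \<open>\<bar>q\<bar>\<close> is larger there than at the centre. There the
  quadratic term is at least \<open>e^4 / 2048\<close>, the linear term at most \<open>11 e^5 / 32\<close> and the others of
  order \<open>e^6\<close>; this dictates the bound on \<open>e\<close>. The factor \<open>1 / 32\<close> in the radius is small enough
  for the zero of the Fekete polynomial to lie within \<open>e\<^sup>2 / p\<close> of the unit circle.
\<close>
lemma zero_near_almost_double_zero:
  fixes q E :: "complex \<Rightarrow> complex" and m s1 s2 e :: real
  assumes e: "0 < e" "e \<le> 1 / 4096"
    and hol: "q holomorphic_on ball 0 (1 / 2)"
    and real: "\<And>x. \<bar>x\<bar> < 1 / 2 \<Longrightarrow> Im (q (of_real x)) = 0"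
    and taylor: "\<And>v. cmod v < 1 / 2 \<Longrightarrow> q v = of_real m - of_real s1 * v + of_real s2 * v\<^sup>2 - v ^ 3 * E v"
    and E: "\<And>v. cmod v < 1 / 2 \<Longrightarrow> cmod (E v) \<le> 12"
    and s2: "1 / 2 \<le> s2" "s2 \<le> 6"
    and m: "\<bar>m\<bar> \<le> 4 * e ^ 6"
  shows "\<exists>v. cmod v \<le> e\<^sup>2 / 32 \<and> q v = 0"
proof -
  define \<rho> where "\<rho> = e\<^sup>2 / 32"
  have e2: "e\<^sup>2 \<le> e / 4096"
    using e by (simp add: power2_eq_square)
  have \<rho>: "0 < \<rho>" "\<rho> < 1 / 2" using e e2 by (auto simp: \<rho>_def)
  have p6: "e ^ 6 \<le> e ^ 4 / 16777216" 
  proof -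
    have "e ^ 4 * e\<^sup>2 \<le> e ^ 4 * (1 / 16777216)"
      using e e2 by (intro mult_left_mono) auto
    then show ?thesis by (simp add: power_add[symmetric])
  qed
  have p5: "e ^ 5 \<le> e ^ 4 / 4096"
  proof -
    have "e ^ 4 * e \<le> e ^ 4 * (1 / 4096)" using e by (intro mult_left_mono) auto
    then show ?thesis by (simp add: power_add[symmetric] power_Suc2[symmetric])
  qed
  have e4: "0 < e ^ 4" using e by simp
  have \<rho>2: "\<rho>\<^sup>2 = e ^ 4 / 1024" and \<rho>3: "\<rho> ^ 3 = e ^ 6 / 32768"
    by (simp_all add: \<rho>_def power_divide power_mult[symmetric])
  let ?r = "\<lambda>x. Re (q (of_real x))"
  have cont: "continuous_on (ball 0 (1 / 2)) q"
    by (rule holomorphic_on_imp_continuous_on[OF hol])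
  have contr: "continuous_on {a..b} ?r" if "-(1 / 2) < a" "b < 1 / 2" for a b
    using that by (intro continuous_intros continuous_on_compose2[OF cont]) auto
  have expand: "\<bar>?r x - (m - s1 * x + s2 * x\<^sup>2)\<bar> \<le> 12 * \<bar>x\<bar> ^ 3" if "\<bar>x\<bar> < 1 / 2" for x
  proof -
    have "?r x - (m - s1 * x + s2 * x\<^sup>2) = - Re (of_real x ^ 3 * E (of_real x))"
      using taylor[of "of_real x"] that by (simp add: of_real_power[symmetric] del: of_real_power)
    also have "\<bar>\<dots>\<bar> \<le> cmod (of_real x ^ 3 * E (of_real x))"
      by (simp only: abs_minus_cancel abs_Re_le_cmod)
    also have "\<dots> = \<bar>x\<bar> ^ 3 * cmod (E (of_real x))" by (simp add: norm_mult norm_power)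
    also have "\<dots> \<le> \<bar>x\<bar> ^ 3 * 12" using E[of "of_real x"] that by (intro mult_left_mono) auto
    finally show ?thesis by simp
  qed
  show ?thesis
  proof (cases "\<exists>x. \<bar>x\<bar> \<le> \<rho> \<and> ?r x \<le> 0")
    case True
    then obtain x where x: "\<bar>x\<bar> \<le> \<rho>" "?r x \<le> 0" by blast
    have "\<rho>\<^sup>2 \<le> 2 * (s2 * \<rho>\<^sup>2)" using s2 mult_right_mono[of 1 "2 * s2" "\<rho>\<^sup>2"] by simp
    then have "0 < ?r \<rho> + ?r (- \<rho>)"
    proof -
      have "m - s1 * \<rho> + s2 * \<rho>\<^sup>2 - 12 * \<rho> ^ 3 \<le> ?r \<rho>"
      proof -
        have "\<bar>?r \<rho> - (m - s1 * \<rho> + s2 * \<rho>\<^sup>2)\<bar> \<le> 12 * \<rho> ^ 3"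
          using expand[of \<rho>] \<rho> by simp
        then show ?thesis by linarith
      qed
      moreover have "m + s1 * \<rho> + s2 * \<rho>\<^sup>2 - 12 * \<rho> ^ 3 \<le> ?r (- \<rho>)"
      proof -
        have "\<bar>?r (- \<rho>) - (m + s1 * \<rho> + s2 * \<rho>\<^sup>2)\<bar> \<le> 12 * \<rho> ^ 3"
          using expand[of "- \<rho>"] \<rho> by simp
        then show ?thesis by linarith
      qed
      ultimately show ?thesis
        using \<open>\<rho>\<^sup>2 \<le> 2 * (s2 * \<rho>\<^sup>2)\<close> \<rho>2 \<rho>3 m p6 e4 by linarith
    qed
    then have "0 \<le> ?r \<rho> \<or> 0 \<le> ?r (- \<rho>)" by linarith
    then have "\<exists>y. \<bar>y\<bar> \<le> \<rho> \<and> ?r y = 0"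
    proof
      assume "0 \<le> ?r \<rho>"
      then have "\<exists>y\<ge>x. y \<le> \<rho> \<and> ?r y = 0"
        using x \<rho> by (intro IVT' contr) auto
      then obtain y where "x \<le> y" "y \<le> \<rho>" "?r y = 0" by blast
      then show ?thesis using x by (intro exI[of _ y]) linarith
    next
      assume "0 \<le> ?r (- \<rho>)"
      then have "\<exists>y\<ge>-\<rho>. y \<le> x \<and> ?r y = 0"
        using x \<rho> by (intro IVT2' contr) auto
      then obtain y where "- \<rho> \<le> y" "y \<le> x" "?r y = 0" by blast
      then show ?thesis using x by (intro exI[of _ y]) linarith
    qed
    then obtain y where y: "\<bar>y\<bar> \<le> \<rho>" "?r y = 0" by blast
    then have "q (of_real y) = 0" using real[of y] \<rho> by (simp add: complex_eq_iff)
    then show ?thesis using y by (intro exI[of _ "of_real y"]) (simp add: \<rho>_def)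
  next
    case False
    then have pos: "0 < ?r x" if "\<bar>x\<bar> \<le> \<rho>" for x using that by (meson not_le)
    have e3: "0 < e ^ 3" "e ^ 3 \<le> \<rho>" "12 * e ^ 3 \<le> 1"
    proof -
      show "0 < e ^ 3" using e by simp
      have "e\<^sup>2 * e \<le> e\<^sup>2 * (1 / 32)" using e by (intro mult_left_mono) auto
      then show "e ^ 3 \<le> \<rho>" by (simp add: \<rho>_def power2_eq_square power3_eq_cube)
      then show "12 * e ^ 3 \<le> 1" using e e2 by (simp add: \<rho>_def)
    qed
    have e9: "12 * (e ^ 3) ^ 3 \<le> e ^ 6"
    proof -
      have "e ^ 6 * (12 * e ^ 3) \<le> e ^ 6 * 1" using e3 e by (intro mult_left_mono) auto
      moreover have "(e ^ 3) ^ 3 = e ^ 6 * e ^ 3" by (simp flip: power_add power_mult)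
      ultimately show ?thesis by linarith
    qed
    have e33: "(e ^ 3)\<^sup>2 = e ^ 6" by (simp add: power_mult[symmetric])
    have s26: "s2 * e ^ 6 \<le> 6 * e ^ 6" using s2 e by (intro mult_right_mono) auto
    have "\<bar>s1 * e ^ 3\<bar> \<le> 11 * e ^ 6"
    proof -
      have "\<bar>e ^ 3\<bar> < 1 / 2" "\<bar>- (e ^ 3)\<bar> < 1 / 2" "\<bar>e ^ 3\<bar> \<le> \<rho>" "\<bar>- (e ^ 3)\<bar> \<le> \<rho>"
        using e3 \<rho> by auto
      note at = expand[OF this(1)] expand[OF this(2)] pos[OF this(3)] pos[OF this(4)]
      have "\<bar>e ^ 3\<bar> = e ^ 3" using e3 by simp
      with at have "m - s1 * e ^ 3 + s2 * e ^ 6 + 12 * (e ^ 3) ^ 3 > 0"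
          "m + s1 * e ^ 3 + s2 * e ^ 6 + 12 * (e ^ 3) ^ 3 > 0"
        unfolding e33 power2_minus abs_minus_cancel mult_minus_right by linarith+
      then show ?thesis using e9 m s26 by linarith
    qed
    then have "\<bar>s1\<bar> * e ^ 3 \<le> (11 * e ^ 3) * e ^ 3"
    proof -
      have "\<bar>s1 * e ^ 3\<bar> = \<bar>s1\<bar> * e ^ 3" using e by (simp add: abs_mult)
      moreover have "(11 * e ^ 3) * e ^ 3 = 11 * e ^ 6" by (simp flip: power_add)
      ultimately show ?thesis using \<open>\<bar>s1 * e ^ 3\<bar> \<le> 11 * e ^ 6\<close> by linarith
    qed
    then have s1: "\<bar>s1\<bar> \<le> 11 * e ^ 3" using e3(1) by (rule mult_right_le_imp_le)
    have "cmod (q 0) < cmod (q v)" if v: "cmod (0 - v) = \<rho>" for v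
    proof -
      have v': "cmod v = \<rho>" using v by simp
      have "of_real s2 * v\<^sup>2 = q v + (of_real s1 * v + v ^ 3 * E v - of_real m)"
        using taylor[of v] v' \<rho> by simp
      then have "cmod (of_real s2 * v\<^sup>2) \<le> cmod (q v) + (cmod (of_real s1 * v) + cmod (v ^ 3 * E v) + cmod (of_real m))"
        using norm_triangle_ineq[of "q v" "of_real s1 * v + v ^ 3 * E v - of_real m"]
          norm_triangle_ineq4[of "of_real s1 * v + v ^ 3 * E v" "of_real m"]
          norm_triangle_ineq[of "of_real s1 * v" "v ^ 3 * E v"] by simp
      moreover have "cmod (of_real s2 * v\<^sup>2) \<ge> e ^ 4 / 2048"
      proof -
        have "(1 / 2) * \<rho>\<^sup>2 \<le> s2 * \<rho>\<^sup>2" using s2 by (intro mult_right_mono) auto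
        moreover have "cmod (of_real s2 * v\<^sup>2) = s2 * \<rho>\<^sup>2"
          using s2 by (simp add: norm_mult norm_power v')
        ultimately show ?thesis using \<rho>2 by linarith
      qed
      moreover have "cmod (of_real s1 * v) \<le> 11 * e ^ 5 / 32"
      proof -
        have "\<bar>s1\<bar> * \<rho> \<le> (11 * e ^ 3) * \<rho>" using s1 \<rho> by (intro mult_right_mono) auto
        moreover have "(11 * e ^ 3) * \<rho> = 11 * e ^ 5 / 32"
          unfolding \<rho>_def by (simp flip: power_add)
        moreover have "cmod (of_real s1 * v) = \<bar>s1\<bar> * \<rho>" by (simp add: norm_mult v')
        ultimately show ?thesis by linarith
      qed
      moreover have "cmod (v ^ 3 * E v) \<le> 12 * e ^ 6 / 32768"
      proof -
        have "\<rho> ^ 3 * cmod (E v) \<le> \<rho> ^ 3 * 12" using E[of v] v' \<rho> by (intro mult_left_mono) auto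
        moreover have "cmod (v ^ 3 * E v) = \<rho> ^ 3 * cmod (E v)" by (simp add: norm_mult norm_power v')
        ultimately show ?thesis using \<rho>3 by linarith
      qed
      moreover have "cmod (q 0) = \<bar>m\<bar>" using taylor[of 0] by simp
      ultimately show ?thesis using m p5 p6 e4 norm_of_real[of m, where 'a = complex] by linarith
    qed
    then obtain v where "v \<in> ball 0 \<rho>" "q v = 0"
    proof (rule holomorphic_contract_to_zero[of 0 \<rho> q, rotated 3])
      show "continuous_on (cball 0 \<rho>) q" "q holomorphic_on ball 0 \<rho>" "0 < \<rho>"
        using \<rho> by (auto intro!: continuous_on_subset[OF cont] holomorphic_on_subset[OF hol])
    qed auto
    then show ?thesis by (intro exI[of _ v]) (auto simp: \<rho>_def)
  qed
qed

lemma moebius_expansion: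
  fixes b w :: complex
  assumes "1 + b * w \<noteq> 0"
  shows "(b - w) / (1 + b * w) = b - w * (1 + b\<^sup>2) + w\<^sup>2 * (b * (1 + b\<^sup>2))
    - w ^ 3 * (b\<^sup>2 * (1 + b\<^sup>2) / (1 + b * w))"
proof -
  define D where "D = 1 + b * w"
  have D0: "D \<noteq> 0" using assms by (simp add: D_def)
  have "b - w = (b - w * (1 + b\<^sup>2) + w\<^sup>2 * (b * (1 + b\<^sup>2))) * D - w ^ 3 * (b\<^sup>2 * (1 + b\<^sup>2))"
    unfolding D_def by (simp add: algebra_simps power2_eq_square power3_eq_cube)
  then have "(b - w) / D = ((b - w * (1 + b\<^sup>2) + w\<^sup>2 * (b * (1 + b\<^sup>2))) * D - w ^ 3 * (b\<^sup>2 * (1 + b\<^sup>2))) / D"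
    by simp
  also have "\<dots> = b - w * (1 + b\<^sup>2) + w\<^sup>2 * (b * (1 + b\<^sup>2)) - w ^ 3 * (b\<^sup>2 * (1 + b\<^sup>2)) / D"
    using D0 by (simp only: diff_divide_distrib[of "_ * D"] nonzero_mult_div_cancel_right not_False_eq_True)
  finally show ?thesis by (simp add: D_def)
qed

text \<open>
  Rescaling by \<open>a\<close>, the size of the nodes, makes the coefficients of the expansion bounded, and
  the preceding lemma applies. The sum commutes with complex conjugation, hence the zero may be
  taken in the closed upper half plane.
\<close>
lemma zero_of_moebius_sum:
  fixes J :: "'i set" and b c :: "'i \<Rightarrow> real" and a e :: real
  assumes e: "0 < e" "e \<le> 1 / 4096" and a: "0 < a"
    and b: "\<And>k. k \<in> J \<Longrightarrow> \<bar>b k\<bar> \<le> a" and c: "\<And>k. k \<in> J \<Longrightarrow> \<bar>c k\<bar> \<le> 1"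
    and sum: "(\<Sum>k\<in>J. 1 + (b k)\<^sup>2) \<le> 6 * a\<^sup>2"
    and convex: "a ^ 3 / 2 \<le> (\<Sum>k\<in>J. c k * (b k * (1 + (b k)\<^sup>2)))"
    and small: "\<bar>\<Sum>k\<in>J. c k * b k\<bar> \<le> 4 * e ^ 6 * a"
  obtains w :: complex where "cmod w \<le> e\<^sup>2 / (32 * a)" "0 \<le> Im w"
    "(\<Sum>k\<in>J. of_real (c k) * ((of_real (b k) - w) / (1 + of_real (b k) * w))) = 0"
proof -
  define F where "F w = (\<Sum>k\<in>J. of_real (c k) * ((of_real (b k) - w) / (1 + of_real (b k) * w)))"
    for w :: complex
  let ?B = "\<lambda>k. of_real (b k) :: complex" and ?C = "\<lambda>k. of_real (c k) :: complex"
    and ?a = "of_real a :: complex"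
  define m where "m = (\<Sum>k\<in>J. c k * b k) / a"
  define s1 where "s1 = (\<Sum>k\<in>J. c k * (1 + (b k)\<^sup>2)) / a\<^sup>2"
  define s2 where "s2 = (\<Sum>k\<in>J. c k * (b k * (1 + (b k)\<^sup>2))) / a ^ 3"
  define E where "E v = (\<Sum>k\<in>J. ?C k * ((?B k)\<^sup>2 * (1 + (?B k)\<^sup>2) / (1 + ?B k * (v / ?a)))) / ?a ^ 4" for v
  define q where "q v = F (v / ?a) / ?a" for v
  have denom: "1 / 2 \<le> cmod (1 + ?B k * (v / ?a))" if "k \<in> J" "cmod v < 1 / 2" for k v
  proof -
    have "cmod (?B k * (v / ?a)) = \<bar>b k\<bar> / a * cmod v"
      using a by (simp add: norm_mult norm_divide)
    also have "\<dots> \<le> 1 * (1 / 2)" using b[OF that(1)] that(2) a by (intro mult_mono) auto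
    finally have "cmod (?B k * (v / ?a)) \<le> 1 / 2" by simp
    then show ?thesis using norm_triangle_ineq4[of "1 + ?B k * (v / ?a)" "?B k * (v / ?a)"] by simp
  qed
  have denom0: "1 + ?B k * (v / ?a) \<noteq> 0" if "k \<in> J" "cmod v < 1 / 2" for k v
    using denom[OF that] by auto
  have "\<exists>v. cmod v \<le> e\<^sup>2 / 32 \<and> q v = 0"
  proof (rule zero_near_almost_double_zero[OF e, of q m s1 s2 E])
    show "q holomorphic_on ball 0 (1 / 2)"
      unfolding q_def F_def using denom0 a by (intro holomorphic_intros) auto
    show "Im (q (of_real x)) = 0" for x
    proof -
      have "q (of_real x) = of_real ((\<Sum>k\<in>J. c k * ((b k - x / a) / (1 + b k * (x / a)))) / a)"
        by (simp add: q_def F_def)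
      then show ?thesis by (simp only: Im_complex_of_real)
    qed
    show "q v = of_real m - of_real s1 * v + of_real s2 * v\<^sup>2 - v ^ 3 * E v" if v: "cmod v < 1 / 2" for v
    proof -
      let ?w = "v / ?a"
      have term_eq: "?C k * ((?B k - ?w) / (1 + ?B k * ?w)) = ?C k * ?B k - ?w * (?C k * (1 + (?B k)\<^sup>2))
          + ?w\<^sup>2 * (?C k * (?B k * (1 + (?B k)\<^sup>2)))
          - ?w ^ 3 * (?C k * ((?B k)\<^sup>2 * (1 + (?B k)\<^sup>2) / (1 + ?B k * ?w)))" if "k \<in> J" for k
        unfolding moebius_expansion[OF denom0[OF that v]]
        by (simp only: right_diff_distrib distrib_left mult.left_commute[of "?C k"])
      have "F ?w = (\<Sum>k\<in>J. ?C k * ?B k - ?w * (?C k * (1 + (?B k)\<^sup>2))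
          + ?w\<^sup>2 * (?C k * (?B k * (1 + (?B k)\<^sup>2)))
          - ?w ^ 3 * (?C k * ((?B k)\<^sup>2 * (1 + (?B k)\<^sup>2) / (1 + ?B k * ?w))))"
        unfolding F_def by (rule sum.cong[OF refl term_eq])
      also have "\<dots> = ?a * of_real m - ?w * (?a\<^sup>2 * of_real s1) + ?w\<^sup>2 * (?a ^ 3 * of_real s2) - ?w ^ 3 * (?a ^ 4 * E v)"
      proof -
        have "(\<Sum>k\<in>J. ?C k * ?B k) = ?a * of_real m"
          "(\<Sum>k\<in>J. ?C k * (1 + (?B k)\<^sup>2)) = ?a\<^sup>2 * of_real s1"
          "(\<Sum>k\<in>J. ?C k * (?B k * (1 + (?B k)\<^sup>2))) = ?a ^ 3 * of_real s2"
          "(\<Sum>k\<in>J. ?C k * ((?B k)\<^sup>2 * (1 + (?B k)\<^sup>2) / (1 + ?B k * ?w))) = ?a ^ 4 * E v"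
          using a by (simp_all add: m_def s1_def s2_def E_def)
        then show ?thesis by (simp only: sum.distrib sum_subtractf sum_distrib_left[symmetric])
      qed
      also have "\<dots> = ?a * (of_real m - of_real s1 * v + of_real s2 * v\<^sup>2 - v ^ 3 * E v)"
        using a by (simp add: power2_eq_square power3_eq_cube power4_eq_xxxx algebra_simps)
      finally show ?thesis using a by (simp add: q_def)
    qed
    show "cmod (E v) \<le> 12" if v: "cmod v < 1 / 2" for v
    proof -
      have "cmod (\<Sum>k\<in>J. ?C k * ((?B k)\<^sup>2 * (1 + (?B k)\<^sup>2) / (1 + ?B k * (v / ?a))))
          \<le> (\<Sum>k\<in>J. 2 * a\<^sup>2 * (1 + (b k)\<^sup>2))"
      proof (rule sum_norm_le)
        fix k assume k: "k \<in> J"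
        have "cmod (1 + (?B k)\<^sup>2) = 1 + (b k)\<^sup>2"
        proof -
          have "1 + (?B k)\<^sup>2 = of_real (1 + (b k)\<^sup>2)" by simp
          moreover have "0 \<le> 1 + (b k)\<^sup>2" by simp
          ultimately show ?thesis by (simp only: norm_of_real abs_of_nonneg)
        qed
        then have "cmod (?C k * ((?B k)\<^sup>2 * (1 + (?B k)\<^sup>2) / (1 + ?B k * (v / ?a))))
          = \<bar>c k\<bar> * ((b k)\<^sup>2 * (1 + (b k)\<^sup>2) / cmod (1 + ?B k * (v / ?a)))"
          by (simp add: norm_mult norm_divide norm_power)
        also have "\<dots> \<le> 1 * (a\<^sup>2 * (1 + (b k)\<^sup>2) / (1 / 2))"
          using c[OF k] b[OF k] denom[OF k v] a abs_le_square_iff[of "b k" a]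
          by (intro mult_mono frac_le) auto
        finally show "cmod (?C k * ((?B k)\<^sup>2 * (1 + (?B k)\<^sup>2) / (1 + ?B k * (v / ?a)))) \<le> 2 * a\<^sup>2 * (1 + (b k)\<^sup>2)"
          by simp
      qed
      also have "\<dots> = 2 * a\<^sup>2 * (\<Sum>k\<in>J. 1 + (b k)\<^sup>2)" by (simp only: sum_distrib_left)
      also have "\<dots> \<le> 2 * a\<^sup>2 * (6 * a\<^sup>2)" using sum by (intro mult_left_mono) auto
      finally have "cmod (\<Sum>k\<in>J. ?C k * ((?B k)\<^sup>2 * (1 + (?B k)\<^sup>2) / (1 + ?B k * (v / ?a)))) \<le> 12 * a ^ 4"
        by (simp add: power2_eq_square power4_eq_xxxx mult_ac)
      then show ?thesis
        unfolding E_def norm_divide norm_power norm_of_real using a by (simp only: divide_le_eq) simp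
    qed
    show "1 / 2 \<le> s2" using convex a by (simp add: s2_def field_simps)
    have "(\<Sum>k\<in>J. c k * (b k * (1 + (b k)\<^sup>2))) \<le> (\<Sum>k\<in>J. a * (1 + (b k)\<^sup>2))"
    proof (rule sum_mono)
      fix k assume k: "k \<in> J"
      have "c k * b k \<le> \<bar>c k\<bar> * \<bar>b k\<bar>" by (metis abs_ge_self abs_mult)
      also have "\<dots> \<le> 1 * a" using c[OF k] b[OF k] by (intro mult_mono) auto
      finally have "c k * b k * (1 + (b k)\<^sup>2) \<le> a * (1 + (b k)\<^sup>2)" by (intro mult_right_mono) auto
      then show "c k * (b k * (1 + (b k)\<^sup>2)) \<le> a * (1 + (b k)\<^sup>2)" by (simp only: mult.assoc)
    qed
    also have "\<dots> \<le> a * (6 * a\<^sup>2)"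
      using sum a by (simp only: sum_distrib_left[symmetric] mult_left_mono order_less_imp_le)
    finally show "s2 \<le> 6" using a by (simp add: s2_def divide_simps power2_eq_square power3_eq_cube mult_ac)
    show "\<bar>m\<bar> \<le> 4 * e ^ 6" using small a by (simp add: m_def field_simps)
  qed
  then obtain v where v: "cmod v \<le> e\<^sup>2 / 32" "q v = 0" by blast
  define w where "w = v / ?a"
  have w: "cmod w \<le> e\<^sup>2 / (32 * a)" "F w = 0"
    using v a by (auto simp: w_def q_def norm_divide field_simps)
  have "F (cnj w) = cnj (F w)" by (simp add: F_def)
  then have "F (cnj w) = 0" using w by simp
  show thesis
  proof (cases "0 \<le> Im w")
    case True
    then show ?thesis using that[of w] w by (simp add: F_def)
  next
    case False
    then show ?thesis using that[of "cnj w"] w \<open>F (cnj w) = 0\<close> by (simp add: F_def)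
  qed
qed

section \<open>Zeros of the Fekete polynomial near an arc\<close>

lemma cis_double_minus_one: "cis (2 * a) - 1 = 2 * \<i> * of_real (sin a) * cis a"
proof -
  have "cis (2 * a) = cis a * cis a" by (simp add: cis_mult)
  moreover have "(1 :: complex) = cis (- a) * cis a" by (simp add: cis_mult)
  moreover have "cis a - cis (- a) = 2 * \<i> * of_real (sin a)" by (simp add: complex_eq_iff)
  ultimately show ?thesis by (metis left_diff_distrib)
qed

lemma sin_ge_half:
  fixes y :: real
  assumes "0 \<le> y" "y \<le> pi / 2"
  shows "y / 2 \<le> sin y"
proof -
  have c: "cos (pi / 4) \<le> cos (y / 2)" using assms by (intro cos_monotone_0_pi_le) auto
  then have "(cos (pi / 4))\<^sup>2 \<le> (cos (y / 2))\<^sup>2" by (intro power_mono) (auto simp: cos_45)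
  then have c2: "1 \<le> 2 * (cos (y / 2))\<^sup>2" by (simp add: cos_45 power_divide)
  have c0: "0 < cos (y / 2)" using assms pi_gt_zero by (intro cos_gt_zero_pi) linarith+
  have "y < pi" using assms pi_gt_zero by linarith
  then have "y / 2 \<le> tan (y / 2)" using assms abs_tan_ge[of "y / 2"] tan_pos_pi2_le[of "y / 2"] by simp
  also have "\<dots> \<le> tan (y / 2) * (2 * (cos (y / 2))\<^sup>2)"
    using c2 assms \<open>y < pi\<close> tan_pos_pi2_le[of "y / 2"] by (simp add: mult_le_cancel_left1)
  also have "\<dots> = 2 * sin (y / 2) * cos (y / 2)"
    using c0 by (simp add: tan_def power2_eq_square)
  also have "\<dots> = sin y" using sin_double[of "y / 2"] by simp
  finally show ?thesis .
qed

lemma sin_pi_mult_ge: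
  fixes x :: real
  assumes "0 \<le> x" "x \<le> 1"
  shows "pi / 2 * min x (1 - x) \<le> sin (pi * x)"
proof (cases "x \<le> 1 / 2")
  case True
  then show ?thesis using assms sin_ge_half[of "pi * x"] by (simp add: min_def mult_ac)
next
  case False
  have "sin (pi * (1 - x)) = sin (pi * x)" using sin_pi_minus[of "pi * x"] by (simp add: algebra_simps)
  moreover have "pi * (1 - x) \<le> pi * (1 / 2)" using False by (intro mult_left_mono) auto
  ultimately show ?thesis using False assms sin_ge_half[of "pi * (1 - x)"] by (simp add: min_def mult_ac)
qed

text \<open>
  The upper half plane goes to the disc, so the radius \<open>exp \<rho>\<close> is at most \<open>1\<close>; both the radius and
  the angle are read off from the logarithm, which is of the order of \<open>w\<close>.
\<close>
lemma cayley_polar: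
  fixes w :: complex and \<delta> :: real
  assumes w: "cmod w \<le> \<delta>" "\<delta> \<le> 1 / 16" "0 \<le> Im w"
  obtains \<rho> \<phi> :: real where
    "(1 + \<i> * w) / (1 - \<i> * w) = of_real (exp \<rho>) * cis \<phi>"
    "- 8 * \<delta> \<le> \<rho>" "\<rho> \<le> 0" "\<bar>\<phi>\<bar> \<le> 8 * \<delta>" "1 - \<i> * w \<noteq> 0"
proof -
  have den: "15 / 16 \<le> cmod (1 - \<i> * w)"
    using norm_triangle_ineq2[of 1 "\<i> * w"] w by (simp add: norm_mult)
  then have den0: "1 - \<i> * w \<noteq> 0" by auto
  define u where "u = 2 * \<i> * w / (1 - \<i> * w)"
  have q: "(1 + \<i> * w) / (1 - \<i> * w) = 1 + u" using den0 by (simp add: u_def field_simps)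
  have "cmod u = 2 * cmod w / cmod (1 - \<i> * w)" by (simp add: u_def norm_mult norm_divide)
  also have "\<dots> \<le> 2 * \<delta> / (15 / 16)" using w den order_trans[OF norm_ge_zero w(1)] by (intro frac_le) auto
  finally have u: "cmod u \<le> 32 / 15 * \<delta>" by simp
  then have u1: "cmod u < 1 / 2" using w by simp
  define L where "L = Ln (1 + u)"
  have L: "cmod L \<le> 8 * \<delta>"
    using norm_Ln_le[OF u1] u order_trans[OF norm_ge_zero w(1)] by (simp add: L_def)
  have ne: "1 + u \<noteq> 0"
  proof
    assume "1 + u = 0"
    then have "u = -1" by (simp add: eq_neg_iff_add_eq_0 add.commute)
    then show False using u1 by simp
  qed
  then have expL: "exp L = 1 + u" by (simp add: L_def)
  have "cmod (1 + \<i> * w) \<le> cmod (1 - \<i> * w)"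
    using w(3) by (simp add: cmod_def power2_eq_square algebra_simps)
  then have "cmod (1 + u) \<le> 1"
    unfolding q[symmetric] norm_divide using den by (simp add: divide_le_eq_1)
  then have "exp (Re L) \<le> 1" by (metis expL norm_exp_eq_Re)
  then have "Re L \<le> 0" by simp
  moreover have "(1 + \<i> * w) / (1 - \<i> * w) = of_real (exp (Re L)) * cis (Im L)"
    unfolding q expL[symmetric] by (simp add: exp_eq_polar)
  moreover have "- 8 * \<delta> \<le> Re L" "\<bar>Im L\<bar> \<le> 8 * \<delta>"
    using L abs_Re_le_cmod[of L] abs_Im_le_cmod[of L] by auto
  ultimately show thesis using den0 that by blast
qed

context odd_prime
begin

lemma zeta_pow_shift_power_p: "zeta_pow p (of_int K + x) ^ p = cis (2 * pi * x)"
proof -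
  have "zeta_pow p (of_int K + x) ^ p = zeta_pow p (of_int (int p * K)) * zeta_pow p (real p * x)"
    by (simp add: zeta_pow_power zeta_pow_add[symmetric] distrib_left)
  moreover have "zeta_pow p (of_int (int p * K)) = 1"
    using zeta_pow_eq_1_iff[of "int p * K"] by simp
  moreover have "zeta_pow p (real p * x) = cis (2 * pi * x)" using p_pos by (simp add: zeta_pow_cis mult.assoc)
  ultimately show ?thesis by simp
qed

lemma gauss_mult_fekete_on_arc:
  fixes K M :: int and x :: real
  assumes x: "0 < x" "x < 1"
  shows "gauss * fekete p (zeta_pow p (of_int K + x)) =
    of_real (sin (pi * x) * (\<Sum>k\<in>{M..<M + int p}. of_int (chi k) * cot_node K x k)) * cis (pi * x)"
proof -
  have "gauss * fekete p (zeta_pow p (of_int K + x)) =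
      - (\<i> / 2) * (zeta_pow p (of_int K + x) ^ p - 1) *
      (\<Sum>k\<in>{M..<M + int p}. of_int (chi k) * of_real (cot_node K x k))"
    using gauss_mult_fekete_eq_cot_sum[OF x, of 0 M K] by simp
  also have "zeta_pow p (of_int K + x) ^ p - 1 = 2 * \<i> * of_real (sin (pi * x)) * cis (pi * x)"
    using cis_double_minus_one[of "pi * x"] by (simp add: zeta_pow_shift_power_p mult_ac)
  finally show ?thesis by (simp add: mult_ac)
qed

text \<open>
  After removal of the phase \<open>cis (\<pi> x)\<close> the function is real on the open arc. The phase turns by
  \<open>\<pi>\<close> along the arc, so equal signs of \<open>\<chi>\<close> at the two ends become opposite values.
\<close>
lemma zero_on_arc_if_same_sign:
  assumes "chi K = chi (K + 1)" "chi K \<noteq> 0"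
  shows "\<exists>x. 0 < x \<and> x < 1 \<and> fekete p (zeta_pow p (of_int K + x)) = 0"
proof -
  define s where "s = real_of_int (chi K)"
  have s: "s * s = 1" using assms chi_cases[of K] by (auto simp: s_def)
  define h where "h x = gauss * fekete p (zeta_pow p (of_int K + x)) * cis (- (pi * x))" for x
  have real: "Im (h x) = 0" if "0 < x" "x < 1" for x
  proof -
    have "h x = of_real (sin (pi * x) * (\<Sum>k\<in>{0..<0 + int p}. of_int (chi k) * cot_node K x k))"
      unfolding h_def gauss_mult_fekete_on_arc[OF that, of K 0]
      by (simp add: mult.assoc cis_mult del: of_real_mult)
    then show ?thesis by (simp only: Im_complex_of_real)
  qed
  have h0: "h 0 = of_real (s * real p)"
    using fekete_zeta_pow_int[of K] gauss_mult_cnj by (simp add: h_def s_def mult_ac)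
  have h1: "h 1 = of_real (- (s * real p))"
  proof -
    have "h 1 = (gauss * cnj gauss) * of_int (chi (K + 1)) * cis (- pi)"
      using fekete_zeta_pow_int[of "K + 1"] by (simp add: h_def mult_ac)
    also have "cis (- pi) = -1" by (simp add: complex_eq_iff)
    finally show ?thesis using assms by (simp add: gauss_mult_cnj s_def)
  qed
  have "continuous_on {0..1} (\<lambda>x. s * Re (h x))"
    unfolding h_def fekete_def zeta_pow_def by (intro continuous_intros) (use p_pos in auto)
  moreover have "s * Re (h 0) = real p" "s * Re (h 1) = - real p"
    using s by (simp_all add: h0 h1 mult.assoc[symmetric])
  ultimately have "\<exists>x\<ge>0. x \<le> 1 \<and> s * Re (h x) = 0" by (intro IVT2') auto
  then obtain x where x: "0 \<le> x" "x \<le> 1" "s * Re (h x) = 0" by blast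
  have "x \<noteq> 0" "x \<noteq> 1"
    using x \<open>s * Re (h 0) = real p\<close> \<open>s * Re (h 1) = - real p\<close> p_pos by auto
  then have x': "0 < x" "x < 1" using x by auto
  have "s \<noteq> 0" using s by auto
  then have "h x = 0" using x real[OF x'] by (simp add: complex_eq_iff)
  then have "fekete p (zeta_pow p (of_int K + x)) = 0" using gauss_nonzero by (simp add: h_def)
  then show ?thesis using x' by blast
qed

text \<open>
  Multiplying \<open>\<chi>\<close> by \<open>\<chi>(K)\<close> gives coefficients \<open>1\<close> at \<open>K\<close> and \<open>-1\<close> at \<open>K + 1\<close>, as needed for
  convexity. The distance \<open>D\<close> from \<open>x\<close> to the nearer end satisfies both
  \<open>sin (\<pi> x) \<ge> \<pi> D / 2\<close> and \<open>p \<le> 2 \<pi> a D\<close>. Hence smallness of \<open>f\<close> yields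
  \<open>\<bar>F(0)\<bar> \<le> 4 \<epsilon> a\<close>, however close \<open>x\<close> is to an end of the arc, and the zero
  \<open>w = O(\<epsilon>^(1/3) / a) = O(\<epsilon>^(1/3) D / p)\<close> moves the angle by less than \<open>D\<close>, so that it stays
  strictly inside the arc.
\<close>
lemma zero_near_arc_if_opposite_signs:
  fixes K :: int and x e :: real
  assumes chi: "chi (K + 1) = - chi K" "chi K \<noteq> 0"
    and x: "0 < x" "x < 1" and e: "0 < e" "e \<le> 1 / 4096"
    and small: "cmod (fekete p (zeta_pow p (of_int K + x))) < e ^ 6 * sqrt (real p)"
  shows "\<exists>r \<theta>. 0 < \<theta> \<and> \<theta> < 1 \<and> 1 - e\<^sup>2 / real p < r \<and> r \<le> 1 \<and>
    fekete p (of_real r * zeta_pow p (of_int K + \<theta>)) = 0"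
proof -
  obtain a M where a: "1 \<le> a"
    and ap: "real p \<le> 2 * pi * a * min x (1 - x)"
    and ba: "\<And>k. k \<in> {M..<M + int p} \<Longrightarrow> \<bar>cot_node K x k\<bar> \<le> a"
    and sum: "(\<Sum>k\<in>{M..<M + int p}. 1 + (cot_node K x k)\<^sup>2) \<le> 6 * a\<^sup>2"
    and convex: "\<And>c :: int \<Rightarrow> real. c K = 1 \<Longrightarrow> c (K + 1) = -1 \<Longrightarrow> (\<And>k. \<bar>c k\<bar> \<le> 1) \<Longrightarrow>
      a ^ 3 / 2 \<le> (\<Sum>k\<in>{M..<M + int p}. c k * (cot_node K x k * (1 + (cot_node K x k)\<^sup>2)))"
  proof (rule cot_node_estimates[OF x, of K], goal_cases)
    case (1 a M)
    show ?case by (rule 1(1); fact 1)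
  qed
  let ?J = "{M..<M + int p}" and ?b = "cot_node K x" and ?D = "min x (1 - x)"
  have D: "0 < ?D" "?D \<le> 1 / 2" using x by (auto simp: min_def)
  define s where "s = real_of_int (chi K)"
  have s: "s * s = 1" "\<bar>s\<bar> = 1" using chi chi_cases[of K] by (auto simp: s_def)
  define c where "c k = s * real_of_int (chi k)" for k
  have c: "c K = 1" "c (K + 1) = -1" "\<bar>c k\<bar> \<le> 1" for k
    using s chi chi_cases[of k] by (auto simp: c_def s_def abs_mult)
  let ?S = "\<Sum>k\<in>?J. of_int (chi k) * ?b k"
  have "sqrt (real p) * cmod (fekete p (zeta_pow p (of_int K + x))) = sin (pi * x) * \<bar>?S\<bar>"
  proof -
    have "0 \<le> sin (pi * x)" using x by (intro sin_ge_zero) auto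
    then show ?thesis
      using arg_cong[OF gauss_mult_fekete_on_arc[OF x, of K M], of cmod]
      by (simp add: norm_mult norm_gauss abs_mult del: of_real_sum of_real_mult)
  qed
  moreover have "sqrt (real p) * cmod (fekete p (zeta_pow p (of_int K + x))) \<le> sqrt (real p) * (e ^ 6 * sqrt (real p))"
    using small by (intro mult_left_mono) auto
  moreover have "sqrt (real p) * (e ^ 6 * sqrt (real p)) = e ^ 6 * real p"
    using real_sqrt_mult_self[of "real p"] by (simp add: mult.left_commute[of "sqrt (real p)"])
  ultimately have "sin (pi * x) * \<bar>?S\<bar> \<le> e ^ 6 * real p" by linarith
  moreover have "pi / 2 * ?D * \<bar>?S\<bar> \<le> sin (pi * x) * \<bar>?S\<bar>"
    using sin_pi_mult_ge[of x] x by (intro mult_right_mono) auto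
  moreover have "e ^ 6 * real p \<le> e ^ 6 * (2 * pi * a * ?D)" using ap e by (intro mult_left_mono) auto
  moreover have "e ^ 6 * (2 * pi * a * ?D) = (pi / 2 * ?D) * (4 * e ^ 6 * a)" by simp
  ultimately have "(pi / 2 * ?D) * \<bar>?S\<bar> \<le> (pi / 2 * ?D) * (4 * e ^ 6 * a)" by linarith
  moreover have "0 < pi / 2 * ?D" using D(1) by (intro mult_pos_pos) auto
  ultimately have S: "\<bar>?S\<bar> \<le> 4 * e ^ 6 * a" by (rule mult_left_le_imp_le)
  have "(\<Sum>k\<in>?J. c k * ?b k) = s * ?S" by (simp add: c_def sum_distrib_left mult.assoc)
  then have cS: "\<bar>\<Sum>k\<in>?J. c k * ?b k\<bar> \<le> 4 * e ^ 6 * a" using S s by (simp add: abs_mult)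
  obtain w where w: "cmod w \<le> e\<^sup>2 / (32 * a)" "0 \<le> Im w"
    and F0: "(\<Sum>k\<in>?J. of_real (c k) * ((of_real (?b k) - w) / (1 + of_real (?b k) * w))) = 0"
    by (rule zero_of_moebius_sum[OF e _ ba c(3) sum convex[OF c] cS]) (use a in auto)
  define \<delta> where "\<delta> = e\<^sup>2 * pi * ?D / (16 * real p)"
  have "e\<^sup>2 / (32 * a) \<le> \<delta>"
  proof -
    have "e\<^sup>2 * real p \<le> e\<^sup>2 * (2 * pi * a * ?D)" using ap by (intro mult_left_mono) auto
    then show ?thesis using a p_pos by (simp add: \<delta>_def divide_simps mult_ac)
  qed
  then have w\<delta>: "cmod w \<le> \<delta>" using w by simp
  have e2: "e\<^sup>2 \<le> 1" using e by (simp add: power_le_one)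
  have p\<delta>: "real p * \<delta> = e\<^sup>2 * pi * ?D / 16" using p_pos by (simp add: \<delta>_def)
  have \<delta>e: "8 * \<delta> < e\<^sup>2 / real p"
  proof -
    have "pi * ?D \<le> pi * (1 / 2)" using D by (intro mult_left_mono) auto
    also have "\<dots> < 2" using pi_less_4 by simp
    finally have "e\<^sup>2 * (pi * ?D) < e\<^sup>2 * 2" using e by (intro mult_strict_left_mono) auto
    moreover have "real p * (8 * \<delta>) = e\<^sup>2 * (pi * ?D) / 2" using p\<delta> by simp
    ultimately have "real p * (8 * \<delta>) < e\<^sup>2" by linarith
    then show ?thesis using p_pos by (simp add: field_simps)
  qed
  moreover have "e\<^sup>2 / real p \<le> 1 / 3" using e2 p_ge_3 by (intro frac_le) auto
  ultimately have \<delta>16: "\<delta> \<le> 1 / 16" by simp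
  obtain \<rho> \<phi> where polar: "(1 + \<i> * w) / (1 - \<i> * w) = of_real (exp \<rho>) * cis \<phi>"
    and \<rho>: "- 8 * \<delta> \<le> \<rho>" "\<rho> \<le> 0" and \<phi>: "\<bar>\<phi>\<bar> \<le> 8 * \<delta>" and iw: "1 - \<i> * w \<noteq> 0"
    by (rule cayley_polar[OF w\<delta> \<delta>16 w(2)])
  define \<theta> where "\<theta> = x + real p * \<phi> / (2 * pi)"
  have bw: "1 + of_real (?b k) * w \<noteq> 0" if "k \<in> ?J" for k
  proof
    assume "1 + of_real (?b k) * w = 0"
    then have "of_real (?b k) * w = -1" by (simp add: eq_neg_iff_add_eq_0 add.commute)
    then have "\<bar>?b k\<bar> * cmod w = 1" by (metis norm_mult norm_of_real norm_minus_cancel norm_one)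
    moreover have "\<bar>?b k\<bar> * cmod w \<le> a * (e\<^sup>2 / (32 * a))"
      using ba[OF that] w a by (intro mult_mono) auto
    ultimately show False using a e2 by simp
  qed
  have "(\<Sum>k\<in>?J. of_int (chi k) * ((of_real (?b k) - w) / (1 + of_real (?b k) * w))) = 0"
  proof -
    have "of_real s * (\<Sum>k\<in>?J. of_int (chi k) * ((of_real (?b k) - w) / (1 + of_real (?b k) * w))) = 0"
      using F0 by (simp add: c_def sum_distrib_left mult.assoc)
    then show ?thesis using s by auto
  qed
  then have "gauss * fekete p (zeta_pow p (of_int K + x) * ((1 + \<i> * w) / (1 - \<i> * w))) = 0"
    using gauss_mult_fekete_eq_cot_sum[OF x iw, of M K] bw by simp
  moreover have "zeta_pow p (of_int K + x) * ((1 + \<i> * w) / (1 - \<i> * w)) =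
      of_real (exp \<rho>) * zeta_pow p (of_int K + \<theta>)"
  proof -
    have "zeta_pow p (real p * \<phi> / (2 * pi)) = cis \<phi>" using p_pos by (simp add: zeta_pow_cis)
    then have "zeta_pow p (of_int K + \<theta>) = zeta_pow p (of_int K + x) * cis \<phi>"
      unfolding \<theta>_def add.assoc[symmetric] zeta_pow_add[of p "of_int K + x"] by simp
    then show ?thesis by (simp add: polar mult_ac)
  qed
  ultimately have zero: "fekete p (of_real (exp \<rho>) * zeta_pow p (of_int K + \<theta>)) = 0"
    using gauss_nonzero by simp
  \<comment> \<open>\<open>\<phi>\<close> is the angle of rotation, and the arc from one root of unity to the next has angle \<open>2 \<pi> / p\<close>\<close>
  have "\<bar>real p * \<phi> / (2 * pi)\<bar> < ?D"
  proof -
    have "\<bar>real p * \<phi> / (2 * pi)\<bar> = real p * \<bar>\<phi>\<bar> / (2 * pi)" by (simp add: abs_mult)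
    also have "\<dots> \<le> real p * (8 * \<delta>) / (2 * pi)"
      using \<phi> by (intro divide_right_mono mult_left_mono) auto
    also have "real p * (8 * \<delta>) = 8 * (real p * \<delta>)" by simp
    also have "\<dots> = e\<^sup>2 * ?D / 4 * (2 * pi)" unfolding p\<delta> by simp
    also have "\<dots> / (2 * pi) = e\<^sup>2 * ?D / 4" by simp
    also have "\<dots> < ?D" using D e2 mult_right_mono[OF e2, of ?D] by simp
    finally show ?thesis .
  qed
  then have "0 < \<theta>" "\<theta> < 1" unfolding \<theta>_def using x by linarith+
  moreover have "1 - e\<^sup>2 / real p < exp \<rho>" using exp_ge_add_one_self[of \<rho>] \<rho> \<delta>e by linarith
  moreover have "exp \<rho> \<le> 1" using \<rho> by simp
  ultimately show ?thesis using zero by blast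
qed

end

theorem theorem3:
  shows "\<exists>\<epsilon>0::real. \<epsilon>0 > 0 \<and>
    (\<forall>\<epsilon>::real. 0 < \<epsilon> \<and> \<epsilon> < \<epsilon>0 \<longrightarrow>
      (\<exists>p0::nat. \<forall>p::nat. prime p \<and> odd p \<and> p \<ge> p0 \<longrightarrow>
        (\<forall>K::int. \<not> int p dvd K \<and> \<not> int p dvd (K + 1) \<and>
            (\<exists>t\<in>zeta_arc p K. cmod (fekete p t) < \<epsilon> * sqrt (real p)) \<longrightarrow>
          (\<exists>(r::real) (\<theta>::real) \<tau>::complex.
              0 < \<theta> \<and> \<theta> < 1 \<and>
              1 - \<epsilon> powr (1/3) / real p < r \<and> r \<le> 1 \<and>
              \<tau> = of_real r * zeta_pow p (of_int K + \<theta>) \<and>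
              fekete p \<tau> = 0))))"
proof (rule exI[of _ "(1 / 4096) ^ 6 :: real"], intro conjI allI impI exI[of _ "0::nat"], goal_cases)
  case (2 \<epsilon> p K)
  then interpret odd_prime p by unfold_locales auto
  define e where "e = \<epsilon> powr (1 / 6)"
  have \<epsilon>: "0 < \<epsilon>" "\<epsilon> < (1 / 4096) ^ 6" using 2 by auto
  have e: "0 < e" "e ^ 6 = \<epsilon>" "e\<^sup>2 = \<epsilon> powr (1 / 3)"
    using \<epsilon> by (simp_all add: e_def powr_realpow[symmetric] powr_powr del: powr_numeral)
  have "e \<le> 1 / 4096"
    by (rule ccontr) (use e \<epsilon> power_mono[of "1 / 4096" e 6] in auto)
  have chi: "chi K \<noteq> 0" "chi (K + 1) \<noteq> 0" using 2 by (auto simp: chi_eq_0_iff)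
  obtain x where x: "0 \<le> x" "x \<le> 1" and small: "cmod (fekete p (zeta_pow p (of_int K + x))) < \<epsilon> * sqrt (real p)"
    using 2 by (auto simp: zeta_arc_def)
  have big: "\<not> cmod (fekete p (zeta_pow p (of_int k))) < \<epsilon> * sqrt (real p)" if "chi k \<noteq> 0" for k
  proof -
    have "cmod (fekete p (zeta_pow p (of_int k))) = sqrt (real p)"
      using that chi_cases[of k] by (auto simp: fekete_zeta_pow_int norm_mult norm_gauss)
    moreover have "(1 / 4096) ^ 6 \<le> (1 :: real)" by (rule power_le_one) auto
    then have "\<epsilon> * sqrt (real p) \<le> 1 * sqrt (real p)" using \<epsilon> by (intro mult_right_mono) auto
    ultimately show ?thesis by simp
  qed
  \<comment> \<open>at the ends of the arc \<open>\<bar>f\<bar> = \<surd>p\<close>, which is not small\<close>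
  have "x \<noteq> 0" "x \<noteq> 1" using small big[of K] big[of "K + 1"] chi by auto
  then have x': "0 < x" "x < 1" using x by auto
  have "\<exists>r \<theta>. 0 < \<theta> \<and> \<theta> < 1 \<and> 1 - e\<^sup>2 / real p < r \<and> r \<le> 1 \<and>
    fekete p (of_real r * zeta_pow p (of_int K + \<theta>)) = 0"
  proof (cases "chi K = chi (K + 1)")
    case True
    then obtain \<theta> where "0 < \<theta>" "\<theta> < 1" "fekete p (zeta_pow p (of_int K + \<theta>)) = 0"
      using zero_on_arc_if_same_sign chi by blast
    then show ?thesis using e p_pos by (intro exI[of _ 1] exI[of _ \<theta>]) auto
  next
    case False
    then have "chi (K + 1) = - chi K" using chi chi_cases[of K] chi_cases[of "K + 1"] by auto
    then show ?thesis
      using zero_near_arc_if_opposite_signs[of K x e] chi x' e \<open>e \<le> 1 / 4096\<close> small by simp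
  qed
  then show ?case using e(3) by auto
qed simp

end
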